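(* Let $p$ be an odd prime, let $F/\mathbb{Q}$ be a cyclic extension of degree $p$, let $K=\mathbb{Q}(\zeta_p)$ and $L=FK$, with $\Phi$ as defined in the context. There are infinitely many elements $x\in L^{*}$ such that both 1. $\Phi(\mathrm{N}_{L/K}(x))\notin (L^{*})^{p}$, and 2. $\Phi(\zeta_p\mathrm{N}_{L/K}(x))\notin (L^{*})^{p}$.
   Context: $\zeta_p$ is a fixed primitive $p$-th root of unity and all fields lie in a fixed algebraic closure of $\mathbb{Q}$. $(L^* )^p$ is the group of $p$-th powers of elements of $L^*$. Let $\bar\tau$ be a fixed generator of $\mathrm{Gal}(L/F)$ (cyclic of order $p-1$) and let $e$ be a primitive root modulo $p$. The homomorphism $\Phi:L^*\to L^*$ is $$\Phi(y)=\prod_{j=0}^{p-2}\bar\tau^{j}(y)^{e^{p-2-j}}=y^{e^{p-2}}\,\bar\tau(y)^{e^{p-3}}\cdots\bar\tau^{p-2}(y).$$ *)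

theory Defs
  imports
    "HOL-Algebra.Algebraic_Closure_Type"
    "HOL-Algebra.Finite_Extensions"
    "HOL-Algebra.Generated_Fields"
    "HOL-Algebra.Elementary_Groups"
    "HOL-Algebra.Bij"
    "HOL-Number_Theory.Number_Theory"
begin

text \<open>
  The fixed algebraic closure of the rationals is the type \<open>rat alg_closure\<close>; all fields are
  subfields of it, represented by their underlying sets. The base field is the set \<open>\<rat>\<close>
  of the elements of this type that come from rational numbers.
\<close>

type_synonym qbar = "rat alg_closure"

abbreviation Qbar :: "qbar ring" where
  "Qbar \<equiv> ring_of_type_algebra"

abbreviation subfield_ring :: "qbar set \<Rightarrow> qbar ring" where
  "subfield_ring E \<equiv> Qbar\<lparr>carrier := E\<rparr>"

definition adjoin :: "qbar set \<Rightarrow> qbar \<Rightarrow> qbar set" where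
  "adjoin K a = generate_field Qbar (insert a K)"

definition compositum :: "qbar set \<Rightarrow> qbar set \<Rightarrow> qbar set" where
  "compositum E F = generate_field Qbar (E \<union> F)"

definition finite_extension :: "qbar set \<Rightarrow> qbar set \<Rightarrow> bool" where
  "finite_extension E K \<longleftrightarrow>
     subfield K Qbar \<and> subfield E Qbar \<and> K \<subseteq> E \<and> ring.finite_dimension Qbar K E"

text \<open>
  As in \<^const>\<open>BijGroup\<close>, automorphisms of \<open>E\<close> are extensional: they take the value
  \<^term>\<open>undefined\<close> outside \<open>E\<close>, so that distinct functions are distinct automorphisms.
\<close>

definition Gal :: "qbar set \<Rightarrow> qbar set \<Rightarrow> (qbar \<Rightarrow> qbar) monoid" where
  "Gal E K = (BijGroup E)\<lparr>carrier :=
     {\<sigma> \<in> Bij E. \<sigma> \<in> ring_hom (subfield_ring E) (subfield_ring E) \<and> (\<forall>x\<in>K. \<sigma> x = x)}\<rparr>"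

definition galois_extension :: "qbar set \<Rightarrow> qbar set \<Rightarrow> bool" where
  "galois_extension E K \<longleftrightarrow>
     finite_extension E K \<and> {x \<in> E. \<forall>\<sigma>\<in>carrier (Gal E K). \<sigma> x = x} = K"

definition cyclic_extension :: "nat \<Rightarrow> qbar set \<Rightarrow> qbar set \<Rightarrow> bool" where
  "cyclic_extension n E K \<longleftrightarrow>
     galois_extension E K \<and> cyclic_group (Gal E K) \<and> ring.dimension Qbar n K E"

definition embeddings :: "qbar set \<Rightarrow> qbar set \<Rightarrow> (qbar \<Rightarrow> qbar) set" where
  "embeddings E K =
     {\<sigma> \<in> extensional E. \<sigma> \<in> ring_hom (subfield_ring E) Qbar \<and> (\<forall>x\<in>K. \<sigma> x = x)}"

text \<open>
  The norm of a finite extension \<open>E\<close> of \<open>K\<close>, as the product of all conjugates. There is no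
  inseparability exponent because the characteristic is zero.
\<close>

definition field_norm :: "qbar set \<Rightarrow> qbar set \<Rightarrow> qbar \<Rightarrow> qbar" where
  "field_norm E K x = (\<Prod>\<sigma>\<in>embeddings E K. \<sigma> x)"

definition primitive_root_of_unity :: "nat \<Rightarrow> qbar \<Rightarrow> bool" where
  "primitive_root_of_unity n z \<longleftrightarrow> n > 0 \<and> z ^ n = 1 \<and> (\<forall>k. 0 < k \<and> k < n \<longrightarrow> z ^ k \<noteq> 1)"

definition power_group :: "qbar set \<Rightarrow> nat \<Rightarrow> qbar set" where
  "power_group E n = {y ^ n |y. y \<in> E - {0}}"

definition Phi :: "nat \<Rightarrow> nat \<Rightarrow> (qbar \<Rightarrow> qbar) \<Rightarrow> qbar \<Rightarrow> qbar" where
  "Phi p e \<tau> y = (\<Prod>j = 0..p - 2. ((\<tau> ^^ j) y) ^ (e ^ (p - 2 - j)))"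

end

theory Submission
  imports Defs
begin

text \<open>
  Write \<open>L = \<rat>(\<theta>)\<close> and take \<open>x = \<theta> - a\<close> with an integer \<open>a\<close>. Then \<open>\<Phi>(N x)\<close> is the product of the
  \<open>(\<tau>\<^sup>j \<sigma> \<theta> - a)\<close> to the powers \<open>e\<close> to the \<open>p - 2 - j\<close>. Because \<open>[F(\<zeta>) : F] = p - 1\<close>, the map
  \<open>\<tau>\<^sup>j \<sigma>\<close> fixes \<open>\<theta>\<close> only for \<open>j = 0\<close> and \<open>\<sigma> = id\<close>, so the factor \<open>\<theta> - a\<close> occurs exactly once, with an
  exponent prime to \<open>p\<close>. If a prime \<open>q\<close> outside a finite set divides the minimal polynomial of \<open>\<theta>\<close> at
  \<open>a\<close> exactly once, then some prime of \<open>L\<close> above \<open>q\<close> divides \<open>\<theta> - a\<close> exactly once and none of the other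
  factors, so the product is not a \<open>p\<close>-th power.

  If \<open>\<Phi>(\<zeta> N x)\<close> is a \<open>p\<close>-th power, then \<open>x\<close> is replaced by \<open>x\<^sup>2\<close>. Multiplying \<open>x\<close> by the \<open>p\<close>-th
  powers of the positive integers gives infinitely many elements.
\<close>

section \<open>Integer polynomials\<close>

text \<open>No prime ideals or valuations of \<open>L\<close> are set up. The obstacle is to find
  \<open>q\<close> and \<open>a\<close> and to know which primes to avoid. A nonconstant integer
  polynomial has prime divisors outside any finite set, and passing from \<open>a\<close> to
  \<open>a + q\<close> repairs a value that is divisible by q^2. The primes to avoid divide a
  denominator of a conjugate, a Bezout constant separating \<theta> from another conjugate, or the
  Bezout constant of the minimal polynomial and its derivative.

  The square works because \<Phi> and the norm are multiplicative: if u = \<Phi>(N x) is not a p-th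
  power but \<Phi>(\<zeta> N x) = v^p, then x^2 yields u^2 and u v^p. The second is a p-th power
  only if u is, and as p is odd the same holds for the first.\<close>

lemma int_poly_cong:
  fixes f :: "int poly"
  shows "b - a dvd poly f b - poly f a"
proof (induction f)
  case (pCons c f)
  have "poly (pCons c f) b - poly (pCons c f) a = b * (poly f b - poly f a) + (b - a) * poly f a"
    by (simp add: algebra_simps)
  then show ?case
    using pCons by simp
qed simp

lemma int_poly_taylor:
  fixes f :: "int poly"
  shows "h\<^sup>2 dvd poly f (a + h) - poly f a - h * poly (pderiv f) a"
proof (induction f)
  case (pCons c f)
  have "poly (pCons c f) (a + h) - poly (pCons c f) a - h * poly (pderiv (pCons c f)) a
      = (a + h) * (poly f (a + h) - poly f a - h * poly (pderiv f) a) + h\<^sup>2 * poly (pderiv f) a"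
    by (simp add: algebra_simps pderiv_pCons power2_eq_square)
  then show ?case
    using pCons by simp
qed simp

text \<open>Schur: with \<open>c = f(0)\<close>, the number \<open>f(cDt)/c\<close> is congruent to 1 modulo \<open>D\<close>.\<close>

lemma int_poly_prime_divisor:
  fixes f :: "int poly" and D :: int
  assumes "degree f > 0" and "D \<noteq> 0"
  obtains q a :: int where "prime q" and "\<not> q dvd D" and "q dvd poly f a"
proof (cases "poly f 0 = 0")
  case True
  obtain q :: nat where q: "prime q" "q > nat \<bar>D\<bar>"
    using bigger_prime by blast
  have "\<not> int q dvd D"
    using q(2) \<open>D \<noteq> 0\<close> dvd_imp_le_int[of D "int q"] by auto
  then show ?thesis
    using that[of "int q" 0] q True by auto
next
  case False
  define c where "c = poly f 0"
  obtain c' g where f: "f = pCons c' g"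
    by (cases f)
  have c': "c' = c"
    by (simp add: c_def f)
  have "g \<noteq> 0"
    using assms(1) f by auto
  \<comment> \<open>Writing f = c + X g gives f(cDt) = c (1 + D t g(cDt)); \<open>G\<close> is the
    last summand, with its factor \<open>D\<close> visible.\<close>
  define G where "G = pcompose g [:0, c * D:] * [:0, D:]"
  have val: "poly f (c * D * t) = c * (1 + poly G t)" for t
    by (simp add: f c' G_def poly_pcompose algebra_simps)
  have "c \<noteq> 0"
    using False by (simp add: c_def)
  have "pcompose g [:0, c * D:] \<noteq> 0"
    using \<open>g \<noteq> 0\<close> \<open>c \<noteq> 0\<close> assms(2) by (simp add: pcompose_eq_0_iff)
  then have deg: "degree G > 0"
    using assms(2) by (simp add: G_def degree_mult_eq)
  \<comment> \<open>Away from the roots of G, G + 1 and G + 2 the number 1 + G(t) is none of 1, 0,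
    -1, so it has a prime factor.\<close>
  have "finite {t. poly (G * (G + 1) * (G + 2)) t = 0}"
  proof -
    have "degree (G + 1) > 0" "degree (G + 2) > 0"
      using deg by (simp_all add: degree_add_eq_left)
    then show ?thesis
      using deg by (intro poly_roots_finite) auto
  qed
  then obtain t where t: "poly (G * (G + 1) * (G + 2)) t \<noteq> 0"
    using ex_new_if_finite[of "{t. poly (G * (G + 1) * (G + 2)) t = 0}"] infinite_UNIV_int by auto
  then have "1 + poly G t \<noteq> 0" "\<not> is_unit (1 + poly G t)"
    by (auto simp: abs_if add.commute split: if_splits)
  then obtain q where q: "prime q" "q dvd 1 + poly G t"
    by (rule prime_divisorE)
  have "\<not> q dvd D"
  proof
    assume "q dvd D"
    then have "q dvd poly G t"
      by (simp add: G_def)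
    then have "q dvd 1"
      using q(2) by (metis dvd_add_left_iff)
    then show False
      using q(1) not_prime_unit by blast
  qed
  moreover have "q dvd poly f (c * D * t)"
    using val q(2) by simp
  ultimately show ?thesis
    using that q(1) by blast
qed

text \<open>Newton iteration: each correction is divisible by \<open>q\<close>, so the residue
  modulo \<open>q\<close> is kept and the derivative stays invertible there. The induction carries
  the exponent \<open>Suc s\<close> because its base is then the hypothesis on
  \<open>a\<close>.\<close>

lemma int_poly_hensel:
  fixes f :: "int poly" and q a :: int
  assumes "prime q" and "q dvd poly f a" and "\<not> q dvd poly (pderiv f) a"
  obtains b where "q dvd b - a" and "q ^ s dvd poly f b"
proof -
  have "\<exists>b. q dvd b - a \<and> q ^ Suc s dvd poly f b"
  proof (induction s)
    case 0
    then show ?case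
      using assms(2) by (intro exI[of _ a]) simp
  next
    case (Suc s)
    then obtain b where b: "q dvd b - a" "q ^ Suc s dvd poly f b"
      by blast
    have "\<not> q dvd poly (pderiv f) b"
      using int_poly_cong[of b a "pderiv f"] b(1) assms(3) by (metis dvd_diff_commute dvd_trans dvd_diff_right_iff)
    then have "coprime (poly (pderiv f) b) q"
      using assms(1) by (metis coprime_commute prime_imp_coprime)
    then obtain u where u: "[poly (pderiv f) b * u = 1] (mod q)"
      using cong_solve_coprime_int by blast
    obtain k where k: "poly f b = q ^ Suc s * k"
      using b(2) by blast
    \<comment> \<open>This is the Newton step -f(b)/f'(b), with \<open>u\<close> inverting f'(b)
      modulo \<open>q\<close>; it cancels the value and the linear Taylor term modulo one further
      power of \<open>q\<close>.\<close>
    define h where "h = - (q ^ Suc s * k * u)"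
    have "h\<^sup>2 dvd poly f (b + h) - poly f b - h * poly (pderiv f) b"
      by (rule int_poly_taylor)
    moreover have "q ^ Suc (Suc s) dvd h\<^sup>2"
    proof -
      have "q ^ Suc (Suc s) dvd q ^ (Suc s * 2)"
        by (rule le_imp_power_dvd) simp
      also have "\<dots> dvd h\<^sup>2"
        by (rule dvdI[of _ _ "(k * u)\<^sup>2"]) (simp add: h_def power_mult_distrib power_mult mult.assoc power2_eq_square)
      finally show ?thesis .
    qed
    ultimately have 1: "q ^ Suc (Suc s) dvd poly f (b + h) - poly f b - h * poly (pderiv f) b"
      by (metis dvd_trans)
    have "poly f b + h * poly (pderiv f) b = q ^ Suc s * (k * (1 - poly (pderiv f) b * u))"
      by (simp add: k h_def algebra_simps)
    moreover have "q dvd 1 - poly (pderiv f) b * u"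
      using cong_sym[OF u] by (simp only: cong_iff_dvd_diff)
    then have "q ^ Suc s * q dvd q ^ Suc s * (k * (1 - poly (pderiv f) b * u))"
      by (intro mult_dvd_mono dvd_refl dvd_mult)
    ultimately have "q ^ Suc (Suc s) dvd poly f b + h * poly (pderiv f) b"
      by (simp only: power_Suc2)
    with 1 have "q ^ Suc (Suc s) dvd poly f (b + h)"
      by (metis diff_diff_eq dvd_add_right_iff diff_add_cancel add.commute)
    moreover have "q dvd b + h - a"
    proof -
      have "q dvd h"
        by (simp add: h_def)
      with b(1) have "q dvd (b - a) + h"
        by (rule dvd_add)
      then show ?thesis
        by (simp add: algebra_simps)
    qed
    ultimately show ?case
      by blast
  qed
  then show ?thesis
    using that by (metis dvd_trans le_imp_power_dvd lessI less_imp_le_nat)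
qed

section \<open>Integer polynomials at an algebraic number\<close>

definition eval_int_poly :: "int poly \<Rightarrow> 'a::field_char_0 \<Rightarrow> 'a" where
  "eval_int_poly f x = poly (map_poly of_int f) x"

lemma eval_int_poly_0 [simp]: "eval_int_poly 0 x = 0"
  by (simp add: eval_int_poly_def)

lemma eval_int_poly_pCons [simp]:
  "eval_int_poly (pCons c f) x = of_int c + x * eval_int_poly f x"
  by (simp add: eval_int_poly_def map_poly_pCons)

lemma eval_int_poly_add [simp]:
  "eval_int_poly (f + g) x = eval_int_poly f x + eval_int_poly g x"
proof -
  have "map_poly of_int (f + g) = (map_poly of_int f + map_poly of_int g :: 'a poly)"
    by (rule poly_eqI) (simp add: coeff_map_poly)
  then show ?thesis
    by (simp add: eval_int_poly_def)
qed

lemma eval_int_poly_smult [simp]: "eval_int_poly (smult c f) x = of_int c * eval_int_poly f x"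
  by (induction f) (simp_all add: algebra_simps)

lemma eval_int_poly_minus [simp]: "eval_int_poly (- f) x = - eval_int_poly f x"
  using eval_int_poly_smult[of "-1" f x] by simp

lemma eval_int_poly_diff [simp]:
  "eval_int_poly (f - g) x = eval_int_poly f x - eval_int_poly g x"
  using eval_int_poly_add[of f "- g" x] by simp

lemma eval_int_poly_mult [simp]:
  "eval_int_poly (f * g) x = eval_int_poly f x * eval_int_poly g x"
  by (induction f) (simp_all add: algebra_simps)

lemma eval_int_poly_1 [simp]: "eval_int_poly 1 x = 1"
  unfolding one_pCons by simp

lemma eval_int_poly_power [simp]: "eval_int_poly (f ^ n) x = eval_int_poly f x ^ n"
  by (induction n) simp_all

lemma eval_int_poly_prod:
  "eval_int_poly (\<Prod>i\<in>A. f i) x = (\<Prod>i\<in>A. eval_int_poly (f i) x)"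
  by (induction A rule: infinite_finite_induct) simp_all

text \<open>Scaling the dividend by a power of the leading coefficient of \<open>g\<close> avoids
  fractions. The price is the factor \<open>c\<close>, so divisibility holds only up to nonzero
  constants from here on.\<close>

lemma int_poly_pseudo_division:
  fixes f g :: "int poly"
  assumes "g \<noteq> 0"
  obtains c q r where "c \<noteq> 0" and "smult c f = g * q + r" and "r = 0 \<or> degree r < degree g"
proof -
  obtain q r where "pseudo_divmod f g = (q, r)"
    by fastforce
  from pseudo_divmod[OF assms this] show ?thesis
    using that[of "coeff g (degree g) ^ (Suc (degree f) - degree g)" q r] assms by simp
qed

text \<open>Only the degree is minimized: content and sign stay free, so the polynomial is
  determined up to a rational factor.\<close>

definition minimal_int_poly :: "'a::field_char_0 \<Rightarrow> int poly \<Rightarrow> bool" where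
  "minimal_int_poly x m \<longleftrightarrow> m \<noteq> 0 \<and> eval_int_poly m x = 0 \<and>
     (\<forall>f. f \<noteq> 0 \<longrightarrow> eval_int_poly f x = 0 \<longrightarrow> degree m \<le> degree f)"

lemma minimal_int_poly_exists:
  fixes x :: "'a::field_char_0"
  assumes "algebraic x"
  obtains m where "minimal_int_poly x m"
proof -
  obtain f where f: "\<And>i. coeff f i \<in> \<int>" "f \<noteq> 0" "poly f x = 0"
    using algebraicE[OF assms] by blast
  have "\<exists>h. \<forall>i. coeff f i = of_int (h i)"
    using f(1) by (intro choice) (auto elim!: Ints_cases)
  then obtain h :: "nat \<Rightarrow> int" where h: "coeff f i = of_int (h i)" for i
    by blast
  define g where "g = Abs_poly h"
  have "coeff g = h"
    unfolding g_def
  proof (rule coeff_Abs_poly)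
    show "h i = 0" if "i > degree f" for i
      using h[of i] that by (simp add: coeff_eq_0)
  qed
  then have fg: "map_poly of_int g = f"
    by (intro poly_eqI) (simp add: coeff_map_poly h)
  have "g \<noteq> 0" "eval_int_poly g x = 0"
    using f fg by (auto simp: eval_int_poly_def)
  then have "\<exists>m. (m \<noteq> 0 \<and> eval_int_poly m x = 0) \<and>
      (\<forall>f. f \<noteq> 0 \<and> eval_int_poly f x = 0 \<longrightarrow> degree m \<le> degree f)"
    using ex_has_least_nat[of "\<lambda>m. m \<noteq> 0 \<and> eval_int_poly m x = 0" g degree] by blast
  then show ?thesis
    using that by (auto simp: minimal_int_poly_def)
qed

lemma minimal_int_poly_degree_pos:
  assumes "minimal_int_poly x m"
  shows "degree m > 0"
proof (rule ccontr)
  assume "\<not> ?thesis"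
  then obtain c where "m = [:c:]"
    using degree_eq_zeroE by blast
  then show False
    using assms by (auto simp: minimal_int_poly_def)
qed

lemma minimal_int_poly_dvd:
  assumes "minimal_int_poly x m" and "eval_int_poly f x = 0"
  obtains e k where "e \<noteq> 0" and "smult e f = m * k"
proof -
  have m: "m \<noteq> 0" "eval_int_poly m x = 0"
    using assms(1) by (auto simp: minimal_int_poly_def)
  obtain c q r where c: "c \<noteq> 0" "smult c f = m * q + r" "r = 0 \<or> degree r < degree m"
    using int_poly_pseudo_division[OF m(1)] .
  have "eval_int_poly (smult c f) x = eval_int_poly (m * q + r) x"
    by (simp only: c(2))
  then have "eval_int_poly r x = 0"
    using assms(2) m(2) by simp
  then have "r = 0"
    using assms(1) c(3) by (auto simp: minimal_int_poly_def not_le[symmetric])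
  then show ?thesis
    using that[of c q] c by simp
qed

text \<open>A nonzero element \<open>g\<close> of least degree in the ideal generated by
  \<open>f\<close> and \<open>m\<close> divides both up to constants. Since f(x) is nonzero, so is
  g(x); hence the cofactor of \<open>g\<close> in \<open>m\<close> vanishes at \<open>x\<close>, and
  minimality of \<open>m\<close> makes \<open>g\<close> constant.\<close>

lemma minimal_int_poly_bezout:
  fixes x :: "'a::field_char_0"
  assumes "minimal_int_poly x m" and "eval_int_poly f x \<noteq> 0"
  obtains A B D where "D \<noteq> 0" and "A * f + B * m = [:D:]"
proof -
  have m: "m \<noteq> 0" "eval_int_poly m x = 0"
    and min: "\<And>h. h \<noteq> 0 \<Longrightarrow> eval_int_poly h x = 0 \<Longrightarrow> degree m \<le> degree h"
    using assms(1) by (auto simp: minimal_int_poly_def)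
  define J where "J = {A * f + B * m |A B. True}"
  have "m \<in> J"
    unfolding J_def by (intro CollectI exI[of _ 0] exI[of _ 1]) simp
  have "f \<in> J"
    unfolding J_def by (intro CollectI exI[of _ 1] exI[of _ 0]) simp
  have J_comb: "smult c u - v * w \<in> J" if uw: "u \<in> J" "v \<in> J" for c u v w
  proof -
    obtain A B A' B' where "u = A * f + B * m" "v = A' * f + B' * m"
      using uw unfolding J_def by blast
    then have "smult c u - v * w = (smult c A - A' * w) * f + (smult c B - B' * w) * m"
      by (simp add: algebra_simps smult_add_right)
    then show ?thesis
      unfolding J_def by blast
  qed
  obtain g where g: "g \<in> J" "g \<noteq> 0" and least: "\<And>h. h \<in> J \<Longrightarrow> h \<noteq> 0 \<Longrightarrow> degree g \<le> degree h"
    using ex_has_least_nat[of "\<lambda>g. g \<in> J \<and> g \<noteq> 0" m degree] \<open>m \<in> J\<close> m(1) by blast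
  have div: "\<exists>c q. c \<noteq> 0 \<and> smult c h = g * q" if h: "h \<in> J" for h
  proof -
    obtain c q r where c: "c \<noteq> 0" "smult c h = g * q + r" "r = 0 \<or> degree r < degree g"
      using int_poly_pseudo_division[OF g(2)] .
    have "r = smult c h - g * q"
      using c(2) by simp
    then have "r \<in> J"
      using J_comb[OF h g(1)] by simp
    then show ?thesis
      using c least[of r] by fastforce
  qed
  obtain c q where c: "c \<noteq> 0" "smult c m = g * q"
    using div[OF \<open>m \<in> J\<close>] by blast
  obtain c' q' where c': "c' \<noteq> 0" "smult c' f = g * q'"
    using div[OF \<open>f \<in> J\<close>] by blast
  have "eval_int_poly (smult c' f) x = eval_int_poly (g * q') x"
    by (simp only: c'(2))
  then have "eval_int_poly g x \<noteq> 0"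
    using assms(2) c'(1) by auto
  moreover have "eval_int_poly (smult c m) x = eval_int_poly (g * q) x"
    by (simp only: c(2))
  ultimately have "eval_int_poly q x = 0"
    using m(2) by simp
  moreover have "q \<noteq> 0"
    using c m(1) by auto
  ultimately have "degree m \<le> degree q"
    using min by blast
  moreover have "degree m = degree g + degree q"
    using c g(2) \<open>q \<noteq> 0\<close> by (metis degree_mult_eq degree_smult_eq)
  ultimately have "degree g = 0"
    by simp
  then obtain D where "g = [:D:]"
    using degree_eq_zeroE by blast
  then show ?thesis
    using that[of D] g unfolding J_def by auto
qed

text \<open>In characteristic zero the derivative is a nonzero polynomial of smaller degree, so
  minimality keeps it from vanishing at \<open>x\<close>.\<close>

lemma minimal_int_poly_pderiv:
  assumes "minimal_int_poly x m"
  shows "eval_int_poly (pderiv m) x \<noteq> 0"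
proof
  assume "eval_int_poly (pderiv m) x = 0"
  moreover have "pderiv m \<noteq> 0"
    using minimal_int_poly_degree_pos[OF assms] by (simp add: pderiv_eq_0_iff)
  ultimately have "degree m \<le> degree (pderiv m)"
    using assms by (auto simp: minimal_int_poly_def)
  then show False
    using minimal_int_poly_degree_pos[OF assms] by (simp add: degree_pderiv)
qed

section \<open>Products of shifted conjugates that are not powers\<close>

text \<open>Modulo a power of \<open>q\<close> beyond the multiplicity of \<open>y\<close>, nothing
  that determines this multiplicity is lost. This leads from a congruence back to an equation
  between multiplicities.\<close>

lemma multiplicity_eq_if_cong:
  fixes q x y :: int
  assumes "prime q" and "y \<noteq> 0" and "multiplicity q y < s" and "q ^ s dvd x - y"
  shows "multiplicity q x = multiplicity q y"
proof (rule multiplicity_eqI)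
  have q: "\<not> is_unit q"
    using assms(1) not_prime_unit by blast
  have *: "q ^ k dvd x \<longleftrightarrow> q ^ k dvd y" if "k \<le> s" for k
  proof -
    have "q ^ k dvd x - y"
      using assms(4) that by (meson dvd_trans le_imp_power_dvd)
    then show ?thesis
      by (metis dvd_add_left_iff diff_add_cancel add.commute dvd_add_right_iff)
  qed
  show "q ^ multiplicity q y dvd x"
    using * assms(3) by (simp add: multiplicity_dvd)
  show "\<not> q ^ Suc (multiplicity q y) dvd x"
    using * assms(2,3) q by (simp add: power_dvd_iff_le_multiplicity del: power_Suc)
qed

text \<open>For algebraic \<open>x\<close> this is the field \<rat>(x). One integer denominator for
  a whole element makes it easy to clear an identity down to integer polynomials.\<close>

definition rational_values :: "'a::field_char_0 \<Rightarrow> 'a set" where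
  "rational_values x = {eval_int_poly f x / of_int c |f c. c \<noteq> 0}"

text \<open>A prime not dividing \<open>E\<close> cannot divide values of \<open>m\<close> and of
  its derivative at the same point. If q^2 divided both m(a) and m(a + q), the Taylor expansion
  would put q^2 into q m'(a); so one of \<open>a\<close> and \<open>a + q\<close> is a suitable
  point.\<close>

lemma simple_root_mod_prime:
  fixes m :: "int poly" and A B :: "int poly" and D E :: int
  assumes "degree m > 0" and "D \<noteq> 0" and "E \<noteq> 0" and "A * pderiv m + B * m = [:E:]"
  obtains q a :: int where "prime q" and "\<not> q dvd D" and "q dvd poly m a" and "\<not> q\<^sup>2 dvd poly m a"
    and "\<not> q dvd poly (pderiv m) a"
proof -
  obtain q a where q: "prime q" "\<not> q dvd D * E" "q dvd poly m a"
    using int_poly_prime_divisor[OF assms(1), of "D * E"] assms(2,3) by auto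
  have "poly (A * pderiv m + B * m) z = E" for z
    using assms(4) by simp
  then have E: "poly A z * poly (pderiv m) z + poly B z * poly m z = E" for z
    by simp
  have der: "\<not> q dvd poly (pderiv m) z" if "q dvd poly m z" for z
    using E[of z] q(2) that by (metis dvd_add dvd_mult)
  have "q dvd poly m (a + q)"
    using dvd_add[OF _ q(3), of "poly m (a + q) - poly m a"] int_poly_cong[of "a + q" a m] by simp
  have "\<not> q\<^sup>2 dvd poly m a \<or> \<not> q\<^sup>2 dvd poly m (a + q)"
  proof (rule ccontr)
    assume "\<not> ?thesis"
    moreover have "q\<^sup>2 dvd poly m (a + q) - poly m a - q * poly (pderiv m) a"
      by (rule int_poly_taylor)
    moreover have "q * poly (pderiv m) a =
        poly m (a + q) - poly m a - (poly m (a + q) - poly m a - q * poly (pderiv m) a)"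
      by simp
    ultimately have "q\<^sup>2 dvd q * poly (pderiv m) a"
      by (metis dvd_diff)
    then have "q dvd poly (pderiv m) a"
      using q(1) by (auto simp: power2_eq_square)
    then show False
      using der q(3) by blast
  qed
  moreover have "\<not> q dvd D"
    using q(2) by auto
  ultimately show ?thesis
    using that[of q a] that[of q "a + q"] q der \<open>q dvd poly m (a + q)\<close> by auto
qed

text \<open>
  If \<open>w\<^sup>p\<close> were the product, this would be a congruence of integer polynomials in \<open>\<theta>\<close> modulo the
  minimal polynomial \<open>m\<close>. It is evaluated at an integer \<open>b\<close> that is \<open>q\<close>-adically close to a root of
  \<open>m\<close>, where \<open>b - a\<close> is divisible by \<open>q\<close> exactly once and the other factors are units at \<open>q\<close>;
  comparing powers of \<open>q\<close> gives a contradiction.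
\<close>

theorem shifted_product_not_power:
  fixes \<theta> :: "'a::field_char_0" and t :: "'i \<Rightarrow> 'a" and n :: "'i \<Rightarrow> nat"
  assumes "algebraic \<theta>" and "finite I" and "i0 \<in> I" and "t i0 = \<theta>"
    and t_neq: "\<And>i. i \<in> I - {i0} \<Longrightarrow> t i \<noteq> \<theta>"
    and t_rat: "\<And>i. i \<in> I \<Longrightarrow> t i \<in> rational_values \<theta>"
    and "\<not> p dvd n i0"
  obtains a :: int where
    "\<And>w. w \<in> rational_values \<theta> \<Longrightarrow> w ^ p \<noteq> (\<Prod>i\<in>I. (t i - of_int a) ^ n i)"
proof -
  obtain m where m: "minimal_int_poly \<theta> m"
    using minimal_int_poly_exists[OF assms(1)] .
  define I' where "I' = I - {i0}"
  have I: "I = insert i0 I'" "i0 \<notin> I'" "finite I'"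
    using assms(2,3) by (auto simp: I'_def)
  have "\<exists>g d. d \<noteq> 0 \<and> t i = eval_int_poly g \<theta> / of_int d" if "i \<in> I'" for i
    using t_rat[of i] that I(1) unfolding rational_values_def by blast
  then obtain g d where gd: "\<And>i. i \<in> I' \<Longrightarrow> d i \<noteq> 0"
      "\<And>i. i \<in> I' \<Longrightarrow> t i = eval_int_poly (g i) \<theta> / of_int (d i)"
    by metis
  \<comment> \<open>The value of \<open>h i\<close> at \<theta> is d_i (t_i - \<theta>), so it is
    nonzero because t_i differs from \<theta>. Its Bezout constant \<open>D i\<close> controls the
    primes at which the two can meet.\<close>
  define h where "h i = g i - [:0, d i:]" for i
  have "eval_int_poly (h i) \<theta> \<noteq> 0" if "i \<in> I'" for i
    using that gd[of i] t_neq[of i] by (auto simp: h_def I'_def field_simps)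
  then have "\<exists>A B D. D \<noteq> 0 \<and> A * h i + B * m = [:D:]" if "i \<in> I'" for i
    using minimal_int_poly_bezout[OF m, of "h i"] that by metis
  then obtain A B D where D: "\<And>i. i \<in> I' \<Longrightarrow> D i \<noteq> (0::int)"
      "\<And>i. i \<in> I' \<Longrightarrow> A i * h i + B i * m = [:D i:]"
    by metis
  obtain A' B' E where E: "E \<noteq> 0" "A' * pderiv m + B' * m = [:E:]"
    using minimal_int_poly_bezout[OF m minimal_int_poly_pderiv[OF m]] .
  define \<Delta> where "\<Delta> = (\<Prod>i\<in>I'. D i * d i)"
  have "\<Delta> \<noteq> 0"
    using D(1) gd(1) I(3) by (simp add: \<Delta>_def)
  obtain q a where q: "prime q" "\<not> q dvd \<Delta>" "q dvd poly m a" "\<not> q\<^sup>2 dvd poly m a"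
      "\<not> q dvd poly (pderiv m) a"
    using simple_root_mod_prime[OF minimal_int_poly_degree_pos[OF m] \<open>\<Delta> \<noteq> 0\<close> E] .
  have pe: "prime_elem q"
    using q(1) by (rule prime_imp_prime_elem)
  have q_Dd: "\<not> q dvd D i" "\<not> q dvd d i" if "i \<in> I'" for i
  proof -
    have "D i * d i dvd \<Delta>"
      unfolding \<Delta>_def using I(3) that by (rule dvd_prodI)
    then show "\<not> q dvd D i" "\<not> q dvd d i"
      using q(2) by (meson dvd_mult dvd_mult2 dvd_trans)+
  qed
  have "w ^ p \<noteq> (\<Prod>i\<in>I. (t i - of_int a) ^ n i)" if "w \<in> rational_values \<theta>" for w
  proof
    assume eq: "w ^ p = (\<Prod>i\<in>I. (t i - of_int a) ^ n i)"
    obtain f c where fc: "c \<noteq> 0" "w = eval_int_poly f \<theta> / of_int c"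
      using \<open>w \<in> _\<close> unfolding rational_values_def by blast
    \<comment> \<open>This is w^p minus the product, multiplied by c^p and all the d_i^(n_i), with
      \<theta> replaced by the variable.\<close>
    define P where "P = smult (\<Prod>i\<in>I'. d i ^ n i) (f ^ p)
      - smult (c ^ p) ([:- a, 1:] ^ n i0 * (\<Prod>i\<in>I'. (g i - [:a * d i:]) ^ n i))"
    have "eval_int_poly P \<theta> = 0"
    proof -
      have "eval_int_poly f \<theta> ^ p = of_int c ^ p * w ^ p"
        using fc by (simp add: power_divide)
      also have "w ^ p = (\<theta> - of_int a) ^ n i0 * (\<Prod>i\<in>I'. (t i - of_int a) ^ n i)"
        using eq I assms(4) by simp
      finally have 1: "eval_int_poly f \<theta> ^ p
        = of_int c ^ p * (\<theta> - of_int a) ^ n i0 * (\<Prod>i\<in>I'. (t i - of_int a) ^ n i)"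
        by (simp add: mult.assoc)
      have 2: "(\<Prod>i\<in>I'. of_int (d i) ^ n i) * (\<Prod>i\<in>I'. (t i - of_int a) ^ n i)
        = (\<Prod>i\<in>I'. (eval_int_poly (g i) \<theta> - of_int a * of_int (d i)) ^ n i)"
        unfolding prod.distrib[symmetric]
      proof (rule prod.cong)
        fix i assume "i \<in> I'"
        then have "eval_int_poly (g i) \<theta> - of_int a * of_int (d i) = of_int (d i) * (t i - of_int a)"
          using gd[of i] by (simp add: field_simps)
        then show "of_int (d i) ^ n i * (t i - of_int a) ^ n i
            = (eval_int_poly (g i) \<theta> - of_int a * of_int (d i)) ^ n i"
          by (simp add: power_mult_distrib)
      qed simp
      have "eval_int_poly P \<theta> = (\<Prod>i\<in>I'. of_int (d i) ^ n i) * eval_int_poly f \<theta> ^ p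
        - of_int c ^ p * ((\<theta> - of_int a) ^ n i0 *
          (\<Prod>i\<in>I'. (eval_int_poly (g i) \<theta> - of_int a * of_int (d i)) ^ n i))"
        by (simp add: P_def eval_int_poly_prod)
      then show ?thesis
        by (simp add: 1 2[symmetric] algebra_simps)
    qed
    then obtain e k where e: "e \<noteq> 0" "smult e P = m * k"
      using minimal_int_poly_dvd[OF m] by blast
    \<comment> \<open>The exponent exceeds the multiplicity of the number \<open>y\<close> below,
      and it is at least 2, so that q^2 divides m(b). The latter transfers q^2 from b - a to m(a),
      where it is excluded.\<close>
    define s where "s = 2 + multiplicity q e + p * multiplicity q c + n i0"
    obtain b where b: "q dvd b - a" "q ^ s dvd poly m b"
      using int_poly_hensel[OF q(1,3,5)] .
    have "\<not> q\<^sup>2 dvd b - a"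
    proof
      assume "q\<^sup>2 dvd b - a"
      then have "q\<^sup>2 dvd poly m b - poly m a"
        using int_poly_cong by (rule dvd_trans)
      moreover have "q\<^sup>2 dvd poly m b"
        using b(2) by (rule dvd_trans[rotated]) (simp add: s_def power2_eq_square)
      ultimately show False
        using q(4) by (metis dvd_diff_right_iff diff_diff_eq2 dvd_diff diff_add_cancel add_diff_cancel_left')
    qed
    have v_ba: "multiplicity q (b - a) = 1" "b - a \<noteq> 0"
      using b(1) \<open>\<not> q\<^sup>2 dvd b - a\<close> by (auto intro!: multiplicity_eqI simp: power2_eq_square)
    define u where "u = (\<Prod>i\<in>I'. d i ^ n i)"
    define v where "v = (\<Prod>i\<in>I'. (poly (g i) b - a * d i) ^ n i)"
    have "\<not> q dvd u"
      unfolding u_def using q_Dd(2) q(1) I(3)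
      by (auto simp: prime_dvd_prod_iff dest: prime_dvd_power)
    \<comment> \<open>As b is congruent to a, a factor of \<open>v\<close> divisible by
      \<open>q\<close> would make h_i(a) divisible by \<open>q\<close>. Together with q | m(a), the
      Bezout relation would give q | D_i.\<close>
    have "\<not> q dvd v"
    proof
      assume "q dvd v"
      then obtain i where i: "i \<in> I'" "q dvd poly (g i) b - a * d i"
        unfolding v_def using q(1) I(3) by (auto simp: prime_dvd_prod_iff dest: prime_dvd_power)
      have "poly (h i) a = (poly (g i) b - a * d i) - (poly (g i) b - poly (g i) a)"
        by (simp add: h_def)
      moreover have "q dvd poly (g i) b - poly (g i) a"
        using b(1) int_poly_cong by (rule dvd_trans)
      ultimately have "q dvd poly (h i) a"
        using i(2) by (metis dvd_diff)
      moreover have "poly (A i * h i + B i * m) a = D i"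
        using D(2)[OF i(1)] by simp
      then have "poly (A i) a * poly (h i) a + poly (B i) a * poly m a = D i"
        by simp
      ultimately have "q dvd D i"
        using q(3) by (metis dvd_add dvd_mult)
      then show False
        using q_Dd(1)[OF i(1)] by blast
    qed
    have nz: "u \<noteq> 0" "v \<noteq> 0"
      using \<open>\<not> q dvd u\<close> \<open>\<not> q dvd v\<close> by auto
    define y where "y = e * (c ^ p * ((b - a) ^ n i0 * v))"
    have "y \<noteq> 0"
      using e(1) fc(1) v_ba(2) nz by (simp add: y_def)
    have mult_y: "multiplicity q y = multiplicity q e + p * multiplicity q c + n i0"
      unfolding y_def using pe e(1) fc(1) v_ba nz \<open>\<not> q dvd v\<close>
      by (simp add: prime_elem_multiplicity_mult_distrib prime_elem_multiplicity_power_distrib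
          not_dvd_imp_multiplicity_0)
    have "poly (smult e P) b = poly (m * k) b"
      by (simp only: e(2))
    then have "e * (u * poly f b ^ p) - y = poly m b * poly k b"
      by (simp add: P_def u_def v_def y_def poly_prod right_diff_distrib)
    then have "q ^ s dvd e * (u * poly f b ^ p) - y"
      using b(2) by simp
    then have mult_eq: "multiplicity q (e * (u * poly f b ^ p)) = multiplicity q y"
      using mult_y \<open>y \<noteq> 0\<close> q(1) by (intro multiplicity_eq_if_cong[where s = s]) (auto simp: s_def)
    show False
    \<comment> \<open>The multiplicity of 0 has the default value 0, so a root \<open>b\<close> of
      \<open>f\<close> needs its own argument: it would force \<open>n i0\<close> to be 0, a
      multiple of \<open>p\<close>. For p = 0 the power is 1 and the general computation
      applies.\<close>
    proof (cases "poly f b = 0 \<and> p > 0")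
      case True
      then have "multiplicity q y = 0"
        using mult_eq by (simp add: power_0_left)
      then have "n i0 = 0"
        using mult_y by simp
      then show False
        using assms(7) by simp
    next
      case False
      then have "multiplicity q (e * (u * poly f b ^ p)) = multiplicity q e + p * multiplicity q (poly f b)"
        using pe e(1) nz \<open>\<not> q dvd u\<close>
        by (cases "p = 0") (simp_all add: prime_elem_multiplicity_mult_distrib
          prime_elem_multiplicity_power_distrib not_dvd_imp_multiplicity_0)
      then have "p * multiplicity q (poly f b) = p * multiplicity q c + n i0"
        using mult_eq mult_y by simp
      then have "p dvd n i0"
        by (metis dvd_add_right_iff dvd_triv_left)
      then show False
        using assms(7) by blast
    qed
  qed
  then show ?thesis
    using that by blast
qed

section \<open>Subfields and polynomials over them\<close>

text \<open>A set-based predicate inside one field type, so that type-class arithmetic stays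
  available. The inverse of 0 is 0, hence no case distinction; \<open>subfield_Qbar_iff\<close>
  links it to \<open>subfield\<close>.\<close>

definition is_subfield :: "'a::field set \<Rightarrow> bool" where
  "is_subfield S \<longleftrightarrow>
     1 \<in> S \<and> (\<forall>x\<in>S. \<forall>y\<in>S. x - y \<in> S \<and> x * y \<in> S) \<and> (\<forall>x\<in>S. inverse x \<in> S)"

context
  fixes S :: "'a::field set"
  assumes S: "is_subfield S"
begin

lemma is_subfield_1: "1 \<in> S"
  using S by (simp add: is_subfield_def)

lemma is_subfield_diff: "x \<in> S \<Longrightarrow> y \<in> S \<Longrightarrow> x - y \<in> S"
  using S by (simp add: is_subfield_def)

lemma is_subfield_mult: "x \<in> S \<Longrightarrow> y \<in> S \<Longrightarrow> x * y \<in> S"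
  using S by (simp add: is_subfield_def)

lemma is_subfield_inverse: "x \<in> S \<Longrightarrow> inverse x \<in> S"
  using S by (simp add: is_subfield_def)

lemma is_subfield_0: "0 \<in> S"
  using is_subfield_diff[OF is_subfield_1 is_subfield_1] by simp

lemma is_subfield_minus: "x \<in> S \<Longrightarrow> - x \<in> S"
  using is_subfield_diff[OF is_subfield_0] by simp

lemma is_subfield_add: "x \<in> S \<Longrightarrow> y \<in> S \<Longrightarrow> x + y \<in> S"
  using is_subfield_diff[OF _ is_subfield_minus] by simp

lemma is_subfield_divide: "x \<in> S \<Longrightarrow> y \<in> S \<Longrightarrow> x / y \<in> S"
  using is_subfield_mult[OF _ is_subfield_inverse] by (simp add: divide_inverse)

lemma is_subfield_power: "x \<in> S \<Longrightarrow> x ^ n \<in> S"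
  by (induction n) (simp_all add: is_subfield_1 is_subfield_mult)

lemma is_subfield_prod: "(\<And>i. i \<in> A \<Longrightarrow> f i \<in> S) \<Longrightarrow> prod f A \<in> S"
  by (induction A rule: infinite_finite_induct) (simp_all add: is_subfield_1 is_subfield_mult)

lemma is_subfield_sum: "(\<And>i. i \<in> A \<Longrightarrow> f i \<in> S) \<Longrightarrow> sum f A \<in> S"
  by (induction A rule: infinite_finite_induct) (simp_all add: is_subfield_0 is_subfield_add)

lemma is_subfield_of_nat: "of_nat n \<in> S"
  by (induction n) (simp_all add: is_subfield_0 is_subfield_1 is_subfield_add)

lemma is_subfield_of_int: "of_int n \<in> S"
  by (cases n) (simp_all add: is_subfield_minus is_subfield_of_nat del: of_nat_Suc)

end

lemmas is_subfield_closed = is_subfield_0 is_subfield_1 is_subfield_diff is_subfield_mult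
  is_subfield_inverse is_subfield_minus is_subfield_add is_subfield_divide is_subfield_power
  is_subfield_prod is_subfield_sum is_subfield_of_nat is_subfield_of_int

lemma Rats_subset_is_subfield:
  fixes S :: "'a::field_char_0 set"
  assumes "is_subfield S"
  shows "\<rat> \<subseteq> S"
  using assms by (auto elim!: Rats_cases' intro!: is_subfield_closed)

lemma is_subfield_Rats: "is_subfield (\<rat> :: 'a::field_char_0 set)"
  by (simp add: is_subfield_def)

section \<open>Polynomials with coefficients in a subfield\<close>

definition polys_over :: "'a::zero set \<Rightarrow> 'a poly set" where
  "polys_over S = {f. \<forall>i. coeff f i \<in> S}"

lemma polys_over_mono: "S \<subseteq> T \<Longrightarrow> polys_over S \<subseteq> polys_over T"
  by (auto simp: polys_over_def)

lemma polys_over_pCons_iff: "pCons a f \<in> polys_over S \<longleftrightarrow> a \<in> S \<and> f \<in> polys_over S"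
  by (auto simp: polys_over_def coeff_pCons split: nat.splits)

lemma polys_over_induct [consumes 1, case_names 0 pCons]:
  assumes "f \<in> polys_over S" and "P 0"
    and "\<And>a f. a \<in> S \<Longrightarrow> f \<in> polys_over S \<Longrightarrow> P f \<Longrightarrow> P (pCons a f)"
  shows "P f"
  using assms(1) by (induction f) (auto simp: polys_over_pCons_iff intro: assms(2,3))

context
  fixes S :: "'a::field set"
  assumes S: "is_subfield S"
begin

lemma polys_over_0: "0 \<in> polys_over S"
  using S by (simp add: polys_over_def is_subfield_closed)

lemma polys_over_1: "1 \<in> polys_over S"
  using S by (simp add: one_pCons polys_over_pCons_iff polys_over_0 is_subfield_closed)

lemma polys_over_add: "f \<in> polys_over S \<Longrightarrow> g \<in> polys_over S \<Longrightarrow> f + g \<in> polys_over S"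
  using S by (simp add: polys_over_def is_subfield_closed)

lemma polys_over_diff: "f \<in> polys_over S \<Longrightarrow> g \<in> polys_over S \<Longrightarrow> f - g \<in> polys_over S"
  using S by (simp add: polys_over_def is_subfield_closed)

lemma polys_over_mult: "f \<in> polys_over S \<Longrightarrow> g \<in> polys_over S \<Longrightarrow> f * g \<in> polys_over S"
  using S by (simp add: polys_over_def coeff_mult is_subfield_closed)

lemma polys_over_smult: "c \<in> S \<Longrightarrow> f \<in> polys_over S \<Longrightarrow> smult c f \<in> polys_over S"
  using S by (simp add: polys_over_def is_subfield_closed)

lemma polys_over_monom: "c \<in> S \<Longrightarrow> monom c n \<in> polys_over S"
  using S by (simp add: polys_over_def is_subfield_closed)

lemma polys_over_pcompose:
  assumes "f \<in> polys_over S" and "g \<in> polys_over S"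
  shows "pcompose f g \<in> polys_over S"
  using assms(1)
proof (induction rule: polys_over_induct)
  case (pCons a f)
  then show ?case
    by (simp add: pcompose_pCons polys_over_add polys_over_mult assms(2) polys_over_pCons_iff polys_over_0)
qed (simp add: polys_over_0)

lemma poly_in_is_subfield:
  assumes "f \<in> polys_over S" and "S \<subseteq> T" and "is_subfield T" and "x \<in> T"
  shows "poly f x \<in> T"
  using assms(1)
  by (induction rule: polys_over_induct) (use assms(2-4) in \<open>auto intro!: is_subfield_closed\<close>)

text \<open>Long division one coefficient at a time, which keeps quotient and remainder over
  \<open>S\<close>: shifting in \<open>a\<close> raises the degree of the remainder to at most that
  of \<open>g\<close>, and subtracting \<open>smult c g\<close> removes the top term.\<close>

lemma polys_over_division:
  assumes "f \<in> polys_over S" and g: "g \<in> polys_over S" "g \<noteq> 0"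
  shows "\<exists>q\<in>polys_over S. \<exists>r\<in>polys_over S. f = g * q + r \<and> (r = 0 \<or> degree r < degree g)"
  using assms(1)
proof (induction rule: polys_over_induct)
  case 0
  then show ?case
    by (intro bexI[of _ 0]) (simp_all add: polys_over_0)
next
  case (pCons a f)
  then obtain q r where qr: "q \<in> polys_over S" "r \<in> polys_over S" "f = g * q + r"
      "r = 0 \<or> degree r < degree g"
    by blast
  define r' where "r' = pCons a r"
  have r': "r' \<in> polys_over S"
    using pCons(1) qr(2) by (simp add: r'_def polys_over_pCons_iff)
  define c where "c = coeff r' (degree g) / lead_coeff g"
  have "c \<in> S"
    using r' g(1) S unfolding c_def by (simp add: polys_over_def is_subfield_closed)
  have eq: "pCons a f = g * (pCons c q) + (r' - smult c g)"
    by (simp add: qr(3) r'_def algebra_simps)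
  have deg: "degree (r' - smult c g) \<le> degree g"
  proof (rule degree_diff_le)
    show "degree r' \<le> degree g"
      using qr(4) by (auto simp: r'_def degree_pCons_eq_if)
  qed (simp add: degree_smult_le)
  have "coeff (r' - smult c g) (degree g) = 0"
    using g(2) by (simp add: c_def)
  then have "r' - smult c g = 0 \<or> degree (r' - smult c g) < degree g"
    using deg by (metis le_neq_implies_less leading_coeff_0_iff)
  then show ?case
    using eq qr(1) r' \<open>c \<in> S\<close> g(1)
    by (intro bexI[of _ "pCons c q"] bexI[of _ "r' - smult c g"])
       (simp_all add: polys_over_pCons_iff polys_over_diff polys_over_smult)
qed

end

lemma polys_over_Rats_clear_denominators:
  fixes f :: "'a::field_char_0 poly"
  assumes "f \<in> polys_over \<rat>"
  obtains c :: int and g :: "int poly" where "c \<noteq> 0" and "smult (of_int c) f = map_poly of_int g"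
proof -
  have "\<exists>c g. c \<noteq> 0 \<and> smult (of_int c) f = map_poly of_int (g :: int poly)"
    using assms
  proof (induction rule: polys_over_induct)
    case 0
    then show ?case
      by (intro exI[of _ 1] exI[of _ 0]) simp
  next
    case (pCons a f)
    then obtain c g where cg: "c \<noteq> 0" "smult (of_int c) f = map_poly of_int (g :: int poly)"
      by blast
    obtain u v :: int where uv: "v \<noteq> 0" "a = of_int u / of_int v"
      using \<open>a \<in> \<rat>\<close> by (metis Rats_cases' less_irrefl)
    have "smult (of_int (v * c)) (pCons a f) = map_poly of_int (pCons (u * c) (smult v g))"
    proof -
      have "smult (of_int (v * c)) f = smult (of_int v) (map_poly of_int g)"
        by (simp flip: cg(2))
      also have "\<dots> = map_poly of_int (smult v g)"
        by (rule poly_eqI) (simp add: coeff_map_poly)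
      finally show ?thesis
        using uv by (simp add: map_poly_pCons)
    qed
    then show ?case
      using cg(1) uv(1) by (intro exI[of _ "v * c"]) auto
  qed
  then show ?thesis
    using that by blast
qed

section \<open>Simple extensions\<close>

definition adjoin_values :: "'a::field set \<Rightarrow> 'a \<Rightarrow> 'a set" where
  "adjoin_values S x = {poly f x |f. f \<in> polys_over S}"

lemma rational_values_eq_adjoin_values: "rational_values x = adjoin_values \<rat> x"
proof (intro equalityI subsetI)
  fix y assume "y \<in> rational_values x"
  then obtain f c where "y = eval_int_poly f x / of_int c"
    unfolding rational_values_def by blast
  then have "y = poly (smult (1 / of_int c) (map_poly of_int f)) x"
    by (simp add: eval_int_poly_def)
  moreover have "smult (1 / of_int c) (map_poly of_int f) \<in> polys_over (\<rat> :: 'a set)"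
    by (simp add: polys_over_def coeff_map_poly)
  ultimately show "y \<in> adjoin_values \<rat> x"
    unfolding adjoin_values_def by blast
next
  fix y assume "y \<in> adjoin_values \<rat> x"
  then obtain f where f: "f \<in> polys_over \<rat>" "y = poly f x"
    unfolding adjoin_values_def by blast
  obtain c g where cg: "c \<noteq> 0" "smult (of_int c) f = map_poly of_int g"
    using polys_over_Rats_clear_denominators[OF f(1)] .
  have "eval_int_poly g x = of_int c * y"
    unfolding eval_int_poly_def by (simp add: f(2) flip: cg(2))
  then have "y = eval_int_poly g x / of_int c"
    using cg(1) by simp
  then show "y \<in> rational_values x"
    using cg(1) unfolding rational_values_def by blast
qed

lemma adjoin_values_subset:
  assumes "is_subfield S" and "S \<subseteq> T" and "is_subfield T" and "x \<in> T"
  shows "adjoin_values S x \<subseteq> T"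
  using poly_in_is_subfield[OF assms(1) _ assms(2-4)] by (auto simp: adjoin_values_def)

context
  fixes S :: "'a::field set" and x :: 'a
  assumes S: "is_subfield S"
begin

lemma adjoin_values_incl: "S \<subseteq> adjoin_values S x"
proof
  fix c assume "c \<in> S"
  then have "[:c:] \<in> polys_over S" "c = poly [:c:] x"
    using polys_over_0[OF S] by (simp_all add: polys_over_pCons_iff)
  then show "c \<in> adjoin_values S x"
    unfolding adjoin_values_def by blast
qed

lemma adjoin_values_generator: "x \<in> adjoin_values S x"
proof -
  have "[:0, 1:] \<in> polys_over S" "x = poly [:0, 1:] x"
    using S polys_over_0[OF S] by (simp_all add: polys_over_pCons_iff is_subfield_closed)
  then show ?thesis
    unfolding adjoin_values_def by blast
qed

lemma adjoin_values_diff: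
  "y \<in> adjoin_values S x \<Longrightarrow> z \<in> adjoin_values S x \<Longrightarrow> y - z \<in> adjoin_values S x"
  unfolding adjoin_values_def using polys_over_diff[OF S] by (smt (verit) mem_Collect_eq poly_diff)

lemma adjoin_values_mult:
  "y \<in> adjoin_values S x \<Longrightarrow> z \<in> adjoin_values S x \<Longrightarrow> y * z \<in> adjoin_values S x"
  unfolding adjoin_values_def using polys_over_mult[OF S] by (smt (verit) mem_Collect_eq poly_mult)

end

section \<open>Eisenstein's criterion\<close>

lemma eisenstein_aux:
  fixes f g :: "int poly" and q :: int
  assumes "prime q" and "\<And>i. i < degree (f * g) \<Longrightarrow> q dvd coeff (f * g) i"
    and "\<not> q dvd lead_coeff (f * g)" and "\<not> q dvd coeff g 0" and "f * g \<noteq> 0"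
  shows "degree g = 0"
proof -
  have "\<not> q dvd lead_coeff f"
    using assms(3) by (auto simp: lead_coeff_mult)
  define i where "i = (LEAST i. \<not> q dvd coeff f i)"
  have i: "\<not> q dvd coeff f i"
    unfolding i_def by (rule LeastI) (fact \<open>\<not> q dvd lead_coeff f\<close>)
  have less: "q dvd coeff f j" if "j < i" for j
    using not_less_Least[OF that[unfolded i_def]] by simp
  have "i \<le> degree f"
    using i by (metis coeff_eq_0 dvd_0_right not_le)
  have "coeff (f * g) i = (\<Sum>j<i. coeff f j * coeff g (i - j)) + coeff f i * coeff g 0"
    by (simp add: coeff_mult flip: lessThan_Suc_atMost)
  moreover have "q dvd (\<Sum>j<i. coeff f j * coeff g (i - j))"
    using less by (intro dvd_sum) simp
  moreover have "\<not> q dvd coeff f i * coeff g 0"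
    using i assms(1,4) by (simp add: prime_dvd_mult_iff)
  ultimately have "\<not> q dvd coeff (f * g) i"
    by (metis dvd_add_right_iff)
  then have "degree (f * g) \<le> i"
    using assms(2)[of i] by (meson not_le)
  moreover have "degree (f * g) = degree f + degree g"
    using assms(5) by (intro degree_mult_eq) auto
  ultimately show ?thesis
    using \<open>i \<le> degree f\<close> by simp
qed

lemma eisenstein:
  fixes f g :: "int poly" and q :: int
  assumes "prime q" and "\<And>i. i < degree (f * g) \<Longrightarrow> q dvd coeff (f * g) i"
    and "\<not> q dvd lead_coeff (f * g)" and "\<not> q\<^sup>2 dvd coeff (f * g) 0"
  shows "degree f = 0 \<or> degree g = 0"
proof -
  have nz: "f * g \<noteq> 0"
    using assms(3) by auto
  have "\<not> (q dvd coeff f 0 \<and> q dvd coeff g 0)"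
    using assms(4) by (auto simp: power2_eq_square coeff_mult_0 intro: mult_dvd_mono)
  then show ?thesis
    using eisenstein_aux[of q f g] eisenstein_aux[of q g f] assms nz by (auto simp: mult.commute)
qed

text \<open>Gauss's lemma turns a factorization over the rationals into one over the integers.\<close>

lemma minimal_int_poly_eisenstein:
  fixes x :: "'a::field_char_0" and P :: "int poly" and q :: int
  assumes "minimal_int_poly x m" and "eval_int_poly P x = 0" and "lead_coeff P = 1"
    and "prime q" and "\<And>i. i < degree P \<Longrightarrow> q dvd coeff P i" and "\<not> q\<^sup>2 dvd coeff P 0"
  shows "degree m = degree P"
proof -
  obtain c k where ck: "c \<noteq> 0" "smult c P = m * k"
    using minimal_int_poly_dvd[OF assms(1,2)] .
  have m: "m \<noteq> 0" "degree m > 0"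
    using assms(1) minimal_int_poly_degree_pos by (auto simp: minimal_int_poly_def)
  have nz: "P \<noteq> 0" "k \<noteq> 0"
    using assms(3) ck by auto
  have "content P dvd 1"
    using content_dvd_coeff[of P "degree P"] assms(3) by simp
  then have "content P = 1"
    using normalize_content[of P] is_unit_normalize by metis
  then have "content m * content k = \<bar>c\<bar>"
    using content_smult[of c P] ck(2) by (simp add: content_mult abs_mult)
  moreover define f g where "f = primitive_part m" and "g = primitive_part k"
  moreover have "m * k = smult (content m * content k) (f * g)"
    unfolding f_def g_def by (metis content_times_primitive_part mult_smult_left mult_smult_right smult_smult)
  ultimately have eq: "smult c P = smult \<bar>c\<bar> (f * g)"
    using ck(2) by simp
  \<comment> \<open>Contents are nonnegative, so their product is only the absolute value of
    \<open>c\<close>; the sign is absorbed here.\<close>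
  define g' where "g' = smult (sgn c) g"
  have P: "P = f * g'"
  proof (rule poly_eqI)
    fix i
    have "c * coeff P i = \<bar>c\<bar> * coeff (f * g) i"
      using arg_cong[OF eq, of "\<lambda>p. coeff p i"] by simp
    then have "c * coeff P i = c * (sgn c * coeff (f * g) i)"
      by (simp add: abs_sgn mult.assoc)
    then show "coeff P i = coeff (f * g') i"
      using ck(1) by (simp add: g'_def)
  qed
  have "degree f = degree m"
    by (simp add: f_def)
  moreover have "\<not> q dvd lead_coeff P"
    using assms(3,4) not_prime_unit by auto
  ultimately have "degree g' = 0"
    using eisenstein[of q f g'] assms(4-6) m(2) unfolding P by fastforce
  moreover have "degree P = degree f + degree g'"
    using nz(1) unfolding P by (intro degree_mult_eq) auto
  ultimately show ?thesis
    using \<open>degree f = degree m\<close> by simp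
qed

section \<open>Algebraicity, minimal polynomials and degrees\<close>

lemma qbar_algebraic_Rats:
  fixes x :: qbar
  obtains f where "f \<in> polys_over \<rat>" and "f \<noteq> 0" and "poly f x = 0"
proof -
  obtain p :: "rat poly" where p: "p \<noteq> 0" "poly (map_poly to_ac p) x = 0"
    by (rule alg_closure_algebraic)
  have "to_ac r \<in> \<rat>" for r :: rat
  proof -
    obtain a b :: int where "r = of_int a / of_int b"
      by (metis Fract_of_int_quotient Rat_cases)
    then show ?thesis
      by simp
  qed
  then have "map_poly to_ac p \<in> polys_over \<rat>"
    by (simp add: polys_over_def coeff_map_poly)
  moreover have "map_poly to_ac p \<noteq> 0"
    using p(1) by (auto simp: poly_eq_iff coeff_map_poly)
  ultimately show ?thesis
    using that p(2) by blast
qed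

lemma qbar_algebraic: "algebraic (x :: qbar)"
  using qbar_algebraic_Rats[of x] by (auto simp: algebraic_altdef polys_over_def)

text \<open>An algebraic number has a rational polynomial with nonzero constant term, which expresses its
  inverse as a polynomial in it.\<close>

lemma is_subfield_if_subring:
  fixes R :: "qbar set"
  assumes "\<rat> \<subseteq> R" and diff: "\<And>x y. x \<in> R \<Longrightarrow> y \<in> R \<Longrightarrow> x - y \<in> R"
    and mult: "\<And>x y. x \<in> R \<Longrightarrow> y \<in> R \<Longrightarrow> x * y \<in> R"
  shows "is_subfield R"
proof -
  have add: "x + y \<in> R" if "x \<in> R" "y \<in> R" for x y
    using diff[OF that(1) diff[of 0 y]] that assms(1) by auto
  have inv: "inverse x \<in> R" if "x \<in> R" "x \<noteq> 0" for x
  proof -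
    define A where "A f \<longleftrightarrow> f \<in> polys_over (\<rat> :: qbar set) \<and> f \<noteq> 0 \<and> poly f x = 0" for f
    obtain f0 where "A f0"
      unfolding A_def using qbar_algebraic_Rats[of x] by blast
    then obtain f where f: "A f" and min: "\<And>g. A g \<Longrightarrow> degree f \<le> degree g"
      using ex_has_least_nat[of A f0 degree] by blast
    obtain c g where cg: "f = pCons c g"
      by (cases f)
    have g: "g \<in> polys_over \<rat>" "c \<in> \<rat>"
      using f by (auto simp: A_def cg polys_over_pCons_iff)
    have eq: "c + x * poly g x = 0"
      using f by (simp add: A_def cg)
    \<comment> \<open>With zero constant term, cancelling a factor x would leave a polynomial of
      smaller degree vanishing at x.\<close>
    have "c \<noteq> 0"
    proof
      assume "c = 0"
      then have "A g"
        using f g \<open>x \<noteq> 0\<close> by (auto simp: A_def cg)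
      then show False
        using min[of g] by (auto simp: A_def cg)
    qed
    then have "inverse x = - (1 / c) * poly g x"
      using eq \<open>x \<noteq> 0\<close> by (simp add: field_simps) (metis add_eq_0_iff minus_equation_iff mult.commute)
    moreover have "poly g x \<in> R"
      using g(1)
      by (induction rule: polys_over_induct) (use assms(1) that(1) in \<open>auto intro!: add mult\<close>)
    moreover have "- (1 / c) \<in> R"
      using g(2) assms(1) by auto
    ultimately show ?thesis
      using mult by metis
  qed
  have "inverse x \<in> R" if "x \<in> R" for x
    using inv[OF that] that by (cases "x = 0") auto
  then show ?thesis
    using assms by (auto simp: is_subfield_def)
qed

lemma is_subfield_adjoin_values:
  fixes x :: qbar
  assumes "is_subfield S"
  shows "is_subfield (adjoin_values S x)"
proof (rule is_subfield_if_subring)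
  show "\<rat> \<subseteq> adjoin_values S x"
    using Rats_subset_is_subfield[OF assms] adjoin_values_incl[OF assms] by blast
qed (use adjoin_values_diff adjoin_values_mult assms in blast)+

definition minimal_poly_over :: "'a::field set \<Rightarrow> 'a \<Rightarrow> 'a poly \<Rightarrow> bool" where
  "minimal_poly_over S x h \<longleftrightarrow> h \<in> polys_over S \<and> h \<noteq> 0 \<and> poly h x = 0 \<and>
     (\<forall>f\<in>polys_over S. f \<noteq> 0 \<longrightarrow> poly f x = 0 \<longrightarrow> degree h \<le> degree f)"

lemma minimal_poly_over_exists:
  fixes x :: qbar
  assumes "is_subfield S"
  obtains h where "minimal_poly_over S x h"
proof -
  define A where "A f \<longleftrightarrow> f \<in> polys_over S \<and> f \<noteq> 0 \<and> poly f x = 0" for f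
  obtain f0 where "A f0"
    unfolding A_def using qbar_algebraic_Rats[of x]
    polys_over_mono[OF Rats_subset_is_subfield[OF assms]] by blast
  then obtain h where "A h" and "\<And>g. A g \<Longrightarrow> degree h \<le> degree g"
    using ex_has_least_nat[of A f0 degree] by blast
  then show ?thesis
    using that by (auto simp: minimal_poly_over_def A_def)
qed

lemma minimal_poly_over_dvd:
  fixes x :: "'a::field"
  assumes "is_subfield S" and "minimal_poly_over S x h" and "f \<in> polys_over S" and "poly f x = 0"
  shows "h dvd f"
proof -
  have h: "h \<in> polys_over S" "h \<noteq> 0" "poly h x = 0"
    and min: "\<And>f. f \<in> polys_over S \<Longrightarrow> f \<noteq> 0 \<Longrightarrow> poly f x = 0 \<Longrightarrow> degree h \<le> degree f"
    using assms(2) by (auto simp: minimal_poly_over_def)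
  obtain q r where qr: "r \<in> polys_over S" "f = h * q + r" "r = 0 \<or> degree r < degree h"
    using polys_over_division[OF assms(1,3) h(1,2)] by blast
  have "poly r x = 0"
    using qr(2) h(3) assms(4) by simp
  then have "r = 0"
    using min[OF qr(1)] qr(3) by (meson not_le)
  then show ?thesis
    using qr(2) by simp
qed

lemma minimal_poly_over_degree_pos:
  assumes "minimal_poly_over S x h"
  shows "degree h > 0"
  using assms by (auto simp: minimal_poly_over_def elim!: degree_eq_zeroE intro!: gr0I)

lemma field_Qbar: "Ring.field Qbar"
  by (rule field_from_type_algebra)

interpretation Qbar: Ring.domain Qbar
  using field_Qbar by (rule Ring.field.axioms)

lemma Qbar_simps [simp]:
  "carrier Qbar = UNIV" "\<one>\<^bsub>Qbar\<^esub> = 1" "\<zero>\<^bsub>Qbar\<^esub> = 0" "x \<otimes>\<^bsub>Qbar\<^esub> y = x * y" "x \<oplus>\<^bsub>Qbar\<^esub> y = x + y"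
  by (simp_all add: ring_of_type_algebra_def)

lemma Qbar_a_inv [simp]: "\<ominus>\<^bsub>Qbar\<^esub> x = - x"
  using Qbar.minus_equality[of "- x" x] by simp

lemma Qbar_m_inv: "x \<noteq> 0 \<Longrightarrow> inv\<^bsub>Qbar\<^esub> x = inverse x"
  using Qbar.comm_inv_char[of x "inverse x"] by simp

lemma subfield_Qbar_iff: "subfield S Qbar \<longleftrightarrow> is_subfield S"
proof
  assume S: "subfield S Qbar"
  note ring = subfieldE(1)[OF S]
  have "x - y \<in> S" if "x \<in> S" "y \<in> S" for x y
    using subringE(5)[OF ring that(2)] subringE(7)[OF ring that(1)] by fastforce
  moreover have "inverse x \<in> S" if "x \<in> S" for x
    using Qbar.subfield_m_inv(1)[OF S, of x] that subringE(2)[OF ring]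
    by (cases "x = 0") (auto simp: Qbar_m_inv)
  ultimately show "is_subfield S"
    using subringE(3,6)[OF ring] by (auto simp: is_subfield_def)
next
  assume S: "is_subfield S"
  have "subring S Qbar"
    by (rule Qbar.subringI) (use S in \<open>auto intro: is_subfield_closed\<close>)
  then show "subfield S Qbar"
    by (rule field.subfieldI'[OF field_Qbar]) (use S in \<open>auto simp: Qbar_m_inv intro: is_subfield_closed\<close>)
qed

text \<open>\<open>E k\<close> is the span of 1, x, ..., x^(k-1). Below the degree of
  \<open>h\<close> each new power is independent of the earlier ones by minimality, and division by
  \<open>h\<close> shows that nothing beyond them is needed.\<close>

lemma dimension_adjoin_values:
  fixes x :: qbar
  assumes S: "is_subfield S" and h: "minimal_poly_over S x h"
  shows "Qbar.dimension (degree h) S (adjoin_values S x)"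
proof -
  define E where "E k = {poly f x |f. f \<in> polys_over S \<and> (\<forall>i\<ge>k. coeff f i = 0)}" for k
  have "Qbar.dimension k S (E k)" if "k \<le> degree h" for k
    using that
  proof (induction k)
    case 0
    have "f = 0" if "\<forall>i. coeff f i = 0" for f :: "qbar poly"
      by (rule poly_eqI) (simp add: that)
    moreover have "0 \<in> E 0"
      unfolding E_def using polys_over_0[OF S] by (intro CollectI exI[of _ 0]) simp
    ultimately have "E 0 = {0}"
      unfolding E_def by auto
    then show ?case
      using Qbar.zero_dim[of S] by simp
  next
    case (Suc k)
    have "x ^ k \<notin> E k"
    proof
      assume "x ^ k \<in> E k"
      then obtain f where f: "f \<in> polys_over S" "\<forall>i\<ge>k. coeff f i = 0" "x ^ k = poly f x"
        unfolding E_def by blast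
      define g where "g = monom 1 k - f"
      have "coeff g k = 1"
        using f(2) by (simp add: g_def)
      then have "g \<noteq> 0"
        by auto
      moreover have "poly g x = 0"
        by (simp add: g_def poly_monom f(3))
      moreover have "g \<in> polys_over S"
        unfolding g_def using S f(1) by (intro polys_over_diff polys_over_monom is_subfield_1)
      ultimately have "degree h \<le> degree g"
        using h by (auto simp: minimal_poly_over_def)
      also have "degree g \<le> k"
        by (rule degree_le) (use f(2) in \<open>auto simp: g_def\<close>)
      finally show False
        using Suc.prems by simp
    qed
    moreover have "E (Suc k) = Qbar.line_extension S (x ^ k) (E k)"
    proof (intro equalityI subsetI)
      fix y assume "y \<in> E (Suc k)"
      then obtain f where f: "f \<in> polys_over S" "\<forall>i\<ge>Suc k. coeff f i = 0" "y = poly f x"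
        unfolding E_def by blast
      define g where "g = f - monom (coeff f k) k"
      have c: "coeff f k \<in> S"
        using f(1) by (simp add: polys_over_def)
      then have "g \<in> polys_over S"
        unfolding g_def using S f(1) by (intro polys_over_diff polys_over_monom)
      moreover have "coeff g i = 0" if "i \<ge> k" for i
        using f(2) that by (cases "i = k") (simp_all add: g_def)
      ultimately have "poly g x \<in> E k"
        unfolding E_def by blast
      moreover have "y = coeff f k * x ^ k + poly g x"
        by (simp add: g_def f(3) poly_monom)
      ultimately show "y \<in> Qbar.line_extension S (x ^ k) (E k)"
        unfolding Qbar.line_extension_mem_iff using c by auto
    next
      fix y assume "y \<in> Qbar.line_extension S (x ^ k) (E k)"
      then obtain c f where f: "c \<in> S" "f \<in> polys_over S" "\<forall>i\<ge>k. coeff f i = 0"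
          "y = c * x ^ k + poly f x"
        unfolding Qbar.line_extension_mem_iff E_def by auto
      have "y = poly (monom c k + f) x"
        by (simp add: f(4) poly_monom)
      moreover have "monom c k + f \<in> polys_over S"
        using S f(1,2) by (intro polys_over_add polys_over_monom)
      moreover have "\<forall>i\<ge>Suc k. coeff (monom c k + f) i = 0"
        using f(3) by auto
      ultimately show "y \<in> E (Suc k)"
        unfolding E_def by blast
    qed
    ultimately show ?case
      using Qbar.Suc_dim[of "x ^ k" "E k" k S] Suc by simp
  qed
  moreover have "adjoin_values S x = E (degree h)"
  proof (intro equalityI subsetI)
    fix y assume "y \<in> adjoin_values S x"
    then obtain f where f: "f \<in> polys_over S" "y = poly f x"
      unfolding adjoin_values_def by blast
    have h': "h \<in> polys_over S" "h \<noteq> 0" "poly h x = 0"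
      using h by (auto simp: minimal_poly_over_def)
    obtain q r where qr: "r \<in> polys_over S" "f = h * q + r" "r = 0 \<or> degree r < degree h"
      using polys_over_division[OF S f(1) h'(1,2)] by blast
    have "y = poly r x"
      using f(2) qr(2) h'(3) by simp
    moreover have "\<forall>i\<ge>degree h. coeff r i = 0"
      using qr(3) by (auto simp: coeff_eq_0)
    ultimately show "y \<in> E (degree h)"
      unfolding E_def using qr(1) by blast
  qed (auto simp: E_def adjoin_values_def)
  ultimately show ?thesis
    by simp
qed

text \<open>A basis over \<open>K\<close> still spans \<open>F\<close> over \<open>E\<close>. Only
  the existence of a dimension is extracted, which is the input for the tower law.\<close>

lemma dimension_over_larger_field:
  fixes K E F :: "qbar set"
  assumes "is_subfield K" and "is_subfield E" and "is_subfield F" and "K \<subseteq> E" and "E \<subseteq> F"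
    and "Qbar.dimension n K F"
  obtains m where "Qbar.dimension m E F"
proof -
  have sf: "subfield K Qbar" "subfield E Qbar" "subfield F Qbar"
    using assms(1-3) by (simp_all add: subfield_Qbar_iff)
  obtain Us where Us: "Qbar.independent K Us" "Qbar.Span K Us = F"
    using Qbar.exists_base[OF sf(1) assms(6)] by blast
  have Span_iff: "y \<in> Qbar.Span S (u # Us) \<longleftrightarrow> (\<exists>k\<in>S. \<exists>v\<in>Qbar.Span S Us. y = k * u + v)" for S y u Us
    using Qbar.line_extension_mem_iff[of y S u "Qbar.Span S Us"] by simp
  have sub1: "Qbar.Span K Vs \<subseteq> Qbar.Span E Vs" for Vs
  proof (induction Vs)
    case (Cons u Vs)
    then show ?case
      using assms(4) unfolding subset_iff Span_iff by blast
  qed simp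
  have sub2: "Qbar.Span E Vs \<subseteq> F" if "set Vs \<subseteq> F" for Vs
    using that
  proof (induction Vs)
    case Nil
    then show ?case
      using assms(3) by (simp add: is_subfield_closed)
  next
    case (Cons u Vs)
    then show ?case
      using assms(3,5) unfolding subset_iff Span_iff
      by (auto intro!: is_subfield_add[OF assms(3)] is_subfield_mult[OF assms(3)])
  qed
  have "set Us \<subseteq> F"
    using Qbar.Span_base_incl[OF sf(1), of Us] Us(2) by simp
  then have "Qbar.Span E Us = F"
    using sub1[of Us] sub2[of Us] Us(2) by blast
  then have "Qbar.finite_dimension E F"
    using Qbar.Span_finite_dimension[OF sf(2), of Us] by simp
  then show ?thesis
    using that by (auto simp: Qbar.finite_dimension_def)
qed

lemma dimension_1_imp_eq:
  fixes E F :: "qbar set"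
  assumes "is_subfield E" and "1 \<in> F" and "Qbar.dimension 1 E F"
  shows "F = E"
proof -
  have sf: "subfield E Qbar"
    using assms(1) by (simp add: subfield_Qbar_iff)
  have "Qbar.independent E [1]"
    by (rule Qbar.li_Cons) simp_all
  then have "Qbar.Span E [1] = F"
    using Qbar.independent_length_eq_dimension[OF sf assms(3), of "[1]"] assms(2) by simp
  moreover have "Qbar.Span E [1] = E"
    using Qbar.line_extension_mem_iff[of _ E 1 "{0}"] by auto
  ultimately show ?thesis
    by simp
qed

text \<open>By the tower law the degree of \<open>x\<close> over \<open>S\<close> divides
  \<open>p\<close>, and degree one would put \<open>x\<close> into \<open>S\<close>; so no room is
  left above S(x).\<close>

lemma adjoin_values_prime_dimension:
  fixes S F :: "qbar set"
  assumes S: "is_subfield S" and F: "is_subfield F" and "S \<subseteq> F" and "prime p"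
    and dim: "Qbar.dimension p S F" and x: "x \<in> F" "x \<notin> S"
  shows "adjoin_values S x = F"
proof -
  define E where "E = adjoin_values S x"
  have E: "is_subfield E" "S \<subseteq> E" "E \<subseteq> F"
    using is_subfield_adjoin_values[OF S] adjoin_values_incl[OF S] adjoin_values_subset[OF S assms(3) F x(1)]
    by (simp_all add: E_def)
  obtain h where h: "minimal_poly_over S x h"
    using minimal_poly_over_exists[OF S] .
  obtain m where m: "Qbar.dimension m E F"
    using dimension_over_larger_field[OF S E(1) F E(2,3) dim] .
  have sf: "subfield S Qbar" "subfield E Qbar"
    using S E(1) by (simp_all add: subfield_Qbar_iff)
  have "Qbar.dimension (degree h * m) S F"
    using Qbar.telescopic_base[OF sf dimension_adjoin_values[OF S h, folded E_def] m] .
  then have "degree h * m = p"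
    using Qbar.dimension_is_inj[OF sf(1) _ dim] by blast
  moreover have "degree h \<noteq> 1"
  proof
    assume "degree h = 1"
    then obtain a b where ab: "h = [:a, b:]" "b \<noteq> 0"
      by (cases h rule: pCons_cases) (auto split: if_splits elim!: degree_eq_zeroE)
    then have "x = - a / b"
      using h by (auto simp: minimal_poly_over_def field_simps add_eq_0_iff)
    moreover have "a \<in> S" "b \<in> S"
      using h by (auto simp: ab minimal_poly_over_def polys_over_pCons_iff)
    ultimately show False
      using x(2) S by (auto intro: is_subfield_closed)
  qed
  ultimately have "m = 1"
    using \<open>prime p\<close> by (metis dvd_triv_left mult_cancel1 nat_mult_1_right prime_nat_iff not_prime_0)
  then have "F = E"
    using m dimension_1_imp_eq[OF E(1), of F] F is_subfield_1 by blast
  then show ?thesis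
    by (simp add: E_def)
qed

section \<open>The cyclotomic polynomial over the rationals and over \<open>F\<close>\<close>

text \<open>This is \<open>((X + 1)\<^sup>p - 1) / X\<close>, which is Eisenstein at \<open>p\<close>.\<close>

definition shifted_cyclotomic :: "nat \<Rightarrow> int poly" where
  "shifted_cyclotomic p = (\<Sum>i<p. monom (int (p choose Suc i)) i)"

lemma coeff_shifted_cyclotomic: "coeff (shifted_cyclotomic p) i = int (p choose Suc i)"
  by (simp add: shifted_cyclotomic_def coeff_sum)

lemma shifted_cyclotomic_degree:
  assumes "p > 0"
  shows "degree (shifted_cyclotomic p) = p - 1" and "lead_coeff (shifted_cyclotomic p) = 1"
proof -
  show "degree (shifted_cyclotomic p) = p - 1"
  proof (rule antisym)
    show "degree (shifted_cyclotomic p) \<le> p - 1"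
      by (rule degree_le) (auto simp: coeff_shifted_cyclotomic)
    show "p - 1 \<le> degree (shifted_cyclotomic p)"
      by (rule le_degree) (use assms in \<open>simp add: coeff_shifted_cyclotomic\<close>)
  qed
  then show "lead_coeff (shifted_cyclotomic p) = 1"
    using assms by (simp add: coeff_shifted_cyclotomic)
qed

lemma mult_eval_shifted_cyclotomic:
  "x * eval_int_poly (shifted_cyclotomic p) x = (x + 1) ^ p - 1"
proof -
  have monom: "eval_int_poly (monom c i) x = of_int c * x ^ i" for c i
    by (simp add: eval_int_poly_def map_poly_monom poly_monom)
  have "eval_int_poly (\<Sum>i\<in>A. f i) x = (\<Sum>i\<in>A. eval_int_poly (f i) x)" for f and A :: "nat set"
    by (induction A rule: infinite_finite_induct) simp_all
  then have "x * eval_int_poly (shifted_cyclotomic p) x = (\<Sum>i<p. of_nat (p choose Suc i) * x ^ Suc i)"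
    by (simp add: shifted_cyclotomic_def monom sum_distrib_left mult.left_commute)
  also have "\<dots> = (\<Sum>i\<le>p. of_nat (p choose i) * x ^ i) - 1"
    by (simp add: sum.atMost_shift)
  also have "(\<Sum>i\<le>p. of_nat (p choose i) * x ^ i) = (x + 1) ^ p"
    by (simp add: binomial_ring)
  finally show ?thesis .
qed

lemma eval_shifted_cyclotomic_eq_0:
  assumes "z ^ p = 1" and "z \<noteq> 1"
  shows "eval_int_poly (shifted_cyclotomic p) (z - 1) = 0"
  using mult_eval_shifted_cyclotomic[of "z - 1" p] assms by simp

text \<open>Eisenstein fixes the degree of an integral minimal polynomial of z - 1; clearing
  denominators carries this lower bound over to rational polynomials.\<close>

lemma minimal_poly_over_Rats_shifted_cyclotomic:
  fixes z :: qbar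
  assumes "prime p" and "z ^ p = 1" and "z \<noteq> 1"
  shows "minimal_poly_over \<rat> (z - 1) (map_poly of_int (shifted_cyclotomic p))"
proof -
  define P where "P = shifted_cyclotomic p"
  have p: "p > 1"
    using assms(1) prime_gt_1_nat by blast
  obtain m where m: "minimal_int_poly (z - 1) m"
    using minimal_int_poly_exists[OF qbar_algebraic] .
  have root: "eval_int_poly P (z - 1) = 0"
    unfolding P_def by (rule eval_shifted_cyclotomic_eq_0[OF assms(2,3)])
  have "degree m = degree P"
  proof (rule minimal_int_poly_eisenstein[OF m root])
    show "lead_coeff P = 1"
      using p shifted_cyclotomic_degree(2) by (simp add: P_def)
    show "prime (int p)"
      using assms(1) by simp
    show "int p dvd coeff P i" if "i < degree P" for i
    proof -
      have "p dvd p choose Suc i"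
        using that p by (intro dvd_choose_prime assms(1)) (auto simp: P_def shifted_cyclotomic_degree)
      then show ?thesis
        by (simp add: P_def coeff_shifted_cyclotomic)
    qed
    \<comment> \<open>The constant coefficient is p choose 1, that is, \<open>p\<close>
      itself.\<close>
    have "\<not> int p * int p dvd int p * 1"
      using p by (subst dvd_mult_cancel_left) auto
    then show "\<not> (int p)\<^sup>2 dvd coeff P 0"
      by (simp add: P_def coeff_shifted_cyclotomic power2_eq_square)
  qed
  have min: "degree P \<le> degree f" if f: "f \<in> polys_over \<rat>" "f \<noteq> 0" "poly f (z - 1) = 0" for f
  proof -
    obtain c g where cg: "c \<noteq> 0" "smult (of_int c) f = map_poly of_int g"
      using polys_over_Rats_clear_denominators[OF f(1)] .
    have "eval_int_poly g (z - 1) = 0"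
      unfolding eval_int_poly_def by (simp add: f(3) flip: cg(2))
    moreover have "g \<noteq> 0"
      using cg f(2) by auto
    ultimately have "degree m \<le> degree g"
      using m by (auto simp: minimal_int_poly_def)
    also have "degree g = degree (smult (of_int c) f)"
      unfolding cg(2) by (simp add: map_poly_degree_eq degree_map_poly)
    finally show ?thesis
      using cg(1) \<open>degree m = degree P\<close> by simp
  qed
  have deg: "degree (map_poly of_int P :: qbar poly) = degree P"
    by (rule degree_map_poly) simp
  then have "map_poly of_int P \<noteq> (0 :: qbar poly)"
    using p by (auto simp: P_def shifted_cyclotomic_degree)
  then show ?thesis
    using min root unfolding minimal_poly_over_def deg P_def[symmetric]
    by (simp add: eval_int_poly_def polys_over_def coeff_map_poly)
qed

text \<open>The degrees \<open>p\<close> of \<open>F\<close> and \<open>p - 1\<close> of \<open>\<rat>(z)\<close> are coprime, so the polynomial stays minimal over \<open>F\<close>.\<close>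

lemma minimal_poly_over_shifted_cyclotomic:
  fixes z :: qbar
  assumes "prime p" and "z ^ p = 1" and "z \<noteq> 1"
    and F: "is_subfield F" and dim: "Qbar.dimension p \<rat> F"
  shows "minimal_poly_over F (z - 1) (map_poly of_int (shifted_cyclotomic p))"
proof -
  define P :: "qbar poly" where "P = map_poly of_int (shifted_cyclotomic p)"
  define x where "x = z - 1"
  have P: "minimal_poly_over \<rat> x P"
    using minimal_poly_over_Rats_shifted_cyclotomic[OF assms(1-3)] by (simp add: P_def x_def)
  have p: "p > 1"
    using assms(1) prime_gt_1_nat by blast
  have deg: "degree P = p - 1"
    unfolding P_def using p by (subst degree_map_poly) (auto simp: shifted_cyclotomic_degree)
  obtain h where h: "minimal_poly_over F x h"
    using minimal_poly_over_exists[OF F] .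
  define K L where "K = adjoin_values \<rat> x" and "L = adjoin_values F x"
  have fields: "is_subfield K" "is_subfield L"
    by (simp_all add: K_def L_def is_subfield_adjoin_values is_subfield_Rats F)
  have "\<rat> \<subseteq> K"
    unfolding K_def by (rule adjoin_values_incl[OF is_subfield_Rats])
  have "K \<subseteq> L"
    unfolding K_def using adjoin_values_subset[OF is_subfield_Rats _ fields(2)]
      Rats_subset_is_subfield[OF fields(2)] adjoin_values_generator[OF F] by (simp add: L_def)
  have sf: "subfield \<rat> Qbar" "subfield F Qbar" "subfield K Qbar"
    using is_subfield_Rats F fields by (simp_all add: subfield_Qbar_iff)
  have dimK: "Qbar.dimension (p - 1) \<rat> K"
    using dimension_adjoin_values[OF is_subfield_Rats P] by (simp add: K_def deg)
  have "Qbar.dimension (degree h) F L"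
    unfolding L_def by (rule dimension_adjoin_values[OF F h])
  then have dimL: "Qbar.dimension (p * degree h) \<rat> L"
    by (rule Qbar.telescopic_base[OF sf(1,2) dim])
  obtain m where "Qbar.dimension m K L"
    using dimension_over_larger_field[OF is_subfield_Rats fields \<open>\<rat> \<subseteq> K\<close> \<open>K \<subseteq> L\<close> dimL] .
  then have "Qbar.dimension ((p - 1) * m) \<rat> L"
    by (rule Qbar.telescopic_base[OF sf(1,3) dimK])
  \<comment> \<open>The two towers through \<open>K\<close> and through \<open>F\<close> compute the
    same degree of \<open>L\<close> over \<rat>.\<close>
  then have "(p - 1) * m = p * degree h"
    using Qbar.dimension_is_inj[OF sf(1) _ dimL] by blast
  then have "p - 1 dvd p * degree h"
    by (metis dvd_triv_left)
  moreover have "coprime (p - 1) p"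
    using p by (metis coprime_diff_one_left_nat less_trans zero_less_one)
  ultimately have "p - 1 dvd degree h"
    by (simp add: coprime_dvd_mult_right_iff)
  then have "degree P \<le> degree h"
    using minimal_poly_over_degree_pos[OF h] deg by (simp add: dvd_imp_le)
  moreover have "P \<in> polys_over F"
    using P polys_over_mono[OF Rats_subset_is_subfield[OF F]] by (auto simp: minimal_poly_over_def)
  ultimately have "minimal_poly_over F x P"
    using P h unfolding minimal_poly_over_def by (meson order.trans)
  then show ?thesis
    by (simp add: P_def x_def)
qed

section \<open>The primitive element theorem\<close>

text \<open>Put \<gamma> = \<alpha> + c \<beta>. The minimal polynomial of \<beta> over
  \<rat>(\<gamma>) divides both g(X) and f(\<gamma> - c X), and \<open>c\<close> is chosen so that
  these share only the root \<beta>. By separability it is linear, so \<beta> lies in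
  \<rat>(\<gamma>).\<close>

lemma primitive_element_qbar:
  fixes \<alpha> \<beta> :: qbar
  obtains n :: int where "\<alpha> \<in> adjoin_values \<rat> (\<alpha> + of_int n * \<beta>)"
    and "\<beta> \<in> adjoin_values \<rat> (\<alpha> + of_int n * \<beta>)"
proof -
  obtain f where f: "f \<in> polys_over \<rat>" "f \<noteq> 0" "poly f \<alpha> = 0"
    using qbar_algebraic_Rats .
  obtain g where g: "g \<in> polys_over \<rat>" "g \<noteq> 0" "poly g \<beta> = 0"
    using qbar_algebraic_Rats .
  \<comment> \<open>These are the bad values of \<open>c\<close>: those with \<gamma> - c b = a for
    roots a of \<open>f\<close> and b of \<open>g\<close>. The pairs with b = \<beta> contribute
    only 0, the default value of division by zero.\<close>
  define B where "B = (\<lambda>(a, b). (a - \<alpha>) / (\<beta> - b)) ` ({a. poly f a = 0} \<times> {b. poly g b = 0})"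
  have "finite B"
    using f(2) g(2) unfolding B_def by (intro finite_imageI finite_cartesian_product poly_roots_finite)
  then have "finite (of_int -` B :: int set)"
    by (rule finite_vimageI) (simp add: inj_def)
  then obtain n :: int where "n \<notin> of_int -` B"
    using ex_new_if_finite infinite_UNIV_int by blast
  define c :: qbar where "c = of_int n"
  have c: "c \<notin> B" "c \<in> \<rat>"
    using \<open>n \<notin> _\<close> by (simp_all add: c_def)
  define \<gamma> where "\<gamma> = \<alpha> + c * \<beta>"
  define S where "S = adjoin_values \<rat> \<gamma>"
  have S: "is_subfield S" "\<rat> \<subseteq> S" "\<gamma> \<in> S"
    using is_subfield_adjoin_values adjoin_values_incl adjoin_values_generator is_subfield_Rats
    by (simp_all add: S_def)
  obtain h where h: "minimal_poly_over S \<beta> h"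
    using minimal_poly_over_exists[OF S(1)] .
  have h': "h \<in> polys_over S" "h \<noteq> 0" "poly h \<beta> = 0"
    and min: "\<And>f. f \<in> polys_over S \<Longrightarrow> f \<noteq> 0 \<Longrightarrow> poly f \<beta> = 0 \<Longrightarrow> degree h \<le> degree f"
    using h by (auto simp: minimal_poly_over_def)
  have fg: "f \<in> polys_over S" "g \<in> polys_over S"
    using f(1) g(1) polys_over_mono[OF S(2)] by auto
  have "h dvd g"
    using minimal_poly_over_dvd[OF S(1) h fg(2) g(3)] .
  have "[:\<gamma>, - c:] \<in> polys_over S"
    using S c(2) by (auto simp: polys_over_pCons_iff polys_over_0 intro!: is_subfield_closed)
  then have "pcompose f [:\<gamma>, - c:] \<in> polys_over S"
    using polys_over_pcompose[OF S(1) fg(1)] by blast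
  moreover have "poly (pcompose f [:\<gamma>, - c:]) \<beta> = 0"
    using f(3) by (simp add: poly_pcompose \<gamma>_def)
  ultimately have "h dvd pcompose f [:\<gamma>, - c:]"
    using minimal_poly_over_dvd[OF S(1) h] by blast
  have root: "b = \<beta>" if b: "poly h b = 0" for b
  proof (rule ccontr)
    assume "b \<noteq> \<beta>"
    have "poly g b = 0" "poly (pcompose f [:\<gamma>, - c:]) b = 0"
      using b \<open>h dvd g\<close> \<open>h dvd pcompose f _\<close> by (auto elim!: dvdE)
    then have "poly g b = 0" "poly f (\<gamma> - c * b) = 0"
      by (simp_all add: poly_pcompose mult.commute)
    moreover have "(\<gamma> - c * b) - \<alpha> = c * (\<beta> - b)"
      by (simp add: \<gamma>_def algebra_simps)
    then have "((\<gamma> - c * b) - \<alpha>) / (\<beta> - b) = c"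
      using \<open>b \<noteq> \<beta>\<close> by simp
    ultimately have "c \<in> B"
      unfolding B_def by (intro image_eqI[of _ _ "(\<gamma> - c * b, b)"]) auto
    then show False
      using c(1) by blast
  qed
  obtain k where k: "h = [:- \<beta>, 1:] * k"
    using h'(3) by (auto simp: poly_eq_0_iff_dvd)
  have "k \<noteq> 0"
    using h'(2) k by auto
  \<comment> \<open>Otherwise \<open>k\<close> has a root, which must again be \<beta>. Then the
    derivative of \<open>h\<close> also vanishes at \<beta>, against minimality of
    \<open>h\<close>.\<close>
  have "degree k = 0"
  proof (rule ccontr)
    assume "degree k \<noteq> 0"
    then obtain b where "poly k b = 0"
      using alg_closed_imp_poly_has_root[of k] by auto
    then have "poly k \<beta> = 0"
      using root[of b] k by simp
    then have "poly (pderiv h) \<beta> = 0"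
      unfolding k pderiv_mult by (simp add: pderiv_pCons)
    moreover have "pderiv h \<noteq> 0"
      using minimal_poly_over_degree_pos[OF h] by (simp add: pderiv_eq_0_iff)
    moreover have "pderiv h \<in> polys_over S"
      using h'(1) S(1) by (auto simp: polys_over_def coeff_pderiv intro!: is_subfield_mult is_subfield_of_nat simp del: of_nat_Suc)
    ultimately have "degree h \<le> degree (pderiv h)"
      by (intro min)
    then show False
      using minimal_poly_over_degree_pos[OF h] by (simp add: degree_pderiv)
  qed
  then obtain u where u: "k = [:u:]"
    using degree_eq_zeroE by blast
  have "- \<beta> * u \<in> S" "u \<in> S" "u \<noteq> 0"
    using h'(1,2) S(1) by (auto simp: k u polys_over_pCons_iff mult.commute)
  then have "- (- \<beta> * u) / u \<in> S"
    using S(1) by (intro is_subfield_divide is_subfield_minus)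
  then have "\<beta> \<in> S"
    using \<open>u \<noteq> 0\<close> by simp
  moreover have "\<alpha> = \<gamma> - c * \<beta>"
    by (simp add: \<gamma>_def)
  then have "\<alpha> \<in> S"
    using S c(2) \<open>\<beta> \<in> S\<close> by (auto intro!: is_subfield_closed)
  ultimately show ?thesis
    using that[of n] by (simp add: S_def \<gamma>_def c_def)
qed

section \<open>Field homomorphisms and Galois groups\<close>

text \<open>The codomain is left open, so that Galois automorphisms, embeddings and iterates of
  \<tau> are all covered.\<close>

definition field_hom_on :: "'a::field set \<Rightarrow> ('a \<Rightarrow> 'a) \<Rightarrow> bool" where
  "field_hom_on E \<sigma> \<longleftrightarrow>
     \<sigma> 1 = 1 \<and> (\<forall>x\<in>E. \<forall>y\<in>E. \<sigma> (x + y) = \<sigma> x + \<sigma> y \<and> \<sigma> (x * y) = \<sigma> x * \<sigma> y)"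

lemma field_hom_on_subset: "field_hom_on E \<sigma> \<Longrightarrow> F \<subseteq> E \<Longrightarrow> field_hom_on F \<sigma>"
  by (auto simp: field_hom_on_def subset_iff)

context
  fixes E :: "'a::field_char_0 set" and \<sigma>
  assumes E: "is_subfield E" and hom: "field_hom_on E \<sigma>"
begin

lemma field_hom_on_1: "\<sigma> 1 = 1"
  and field_hom_on_add: "x \<in> E \<Longrightarrow> y \<in> E \<Longrightarrow> \<sigma> (x + y) = \<sigma> x + \<sigma> y"
  and field_hom_on_mult: "x \<in> E \<Longrightarrow> y \<in> E \<Longrightarrow> \<sigma> (x * y) = \<sigma> x * \<sigma> y"
  using hom by (simp_all add: field_hom_on_def)

lemma field_hom_on_0: "\<sigma> 0 = 0"
  using field_hom_on_add[of 0 0] is_subfield_0[OF E] by simp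

lemma field_hom_on_minus: "x \<in> E \<Longrightarrow> \<sigma> (- x) = - \<sigma> x"
  using field_hom_on_add[of x "- x"] is_subfield_minus[OF E, of x] field_hom_on_0
  by (simp add: eq_neg_iff_add_eq_0 add.commute)

lemma field_hom_on_diff: "x \<in> E \<Longrightarrow> y \<in> E \<Longrightarrow> \<sigma> (x - y) = \<sigma> x - \<sigma> y"
  using field_hom_on_add[of x "- y"] field_hom_on_minus[of y] is_subfield_minus[OF E, of y] by simp

lemma field_hom_on_eq_0_iff: "x \<in> E \<Longrightarrow> \<sigma> x = 0 \<longleftrightarrow> x = 0"
proof
  assume x: "x \<in> E" "\<sigma> x = 0"
  show "x = 0"
  proof (rule ccontr)
    assume "x \<noteq> 0"
    then have "1 = \<sigma> (x * inverse x)"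
      using field_hom_on_1 by simp
    also have "\<dots> = 0"
      using x field_hom_on_mult is_subfield_inverse[OF E] by simp
    finally show False
      by simp
  qed
qed (simp add: field_hom_on_0)

lemma field_hom_on_inj: "inj_on \<sigma> E"
proof (rule inj_onI)
  fix x y assume "x \<in> E" "y \<in> E" "\<sigma> x = \<sigma> y"
  then show "x = y"
    using field_hom_on_diff[of x y] field_hom_on_eq_0_iff[of "x - y"] is_subfield_diff[OF E, of x y]
    by simp
qed

lemma field_hom_on_prod: "(\<And>i. i \<in> A \<Longrightarrow> f i \<in> E) \<Longrightarrow> \<sigma> (prod f A) = (\<Prod>i\<in>A. \<sigma> (f i))"
  by (induction A rule: infinite_finite_induct)
     (simp_all add: field_hom_on_1 field_hom_on_mult is_subfield_prod[OF E])

lemma field_hom_on_of_nat: "\<sigma> (of_nat n) = of_nat n"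
  by (induction n)
     (simp_all add: field_hom_on_0 field_hom_on_1 field_hom_on_add is_subfield_1[OF E] is_subfield_of_nat[OF E])

lemma field_hom_on_of_int: "\<sigma> (of_int n) = of_int n"
  by (cases n) (simp_all add: field_hom_on_minus field_hom_on_of_nat is_subfield_of_nat[OF E] del: of_nat_Suc)

lemma field_hom_on_Rats:
  assumes "x \<in> \<rat>"
  shows "\<sigma> x = x"
proof -
  obtain a b :: int where ab: "b \<noteq> 0" "x = of_int a / of_int b"
    using assms by (metis Rats_cases' less_irrefl)
  have "x \<in> E"
    using assms Rats_subset_is_subfield[OF E] by blast
  then have "\<sigma> (of_int b * x) = of_int b * \<sigma> x"
    using field_hom_on_mult is_subfield_of_int[OF E] by (simp add: field_hom_on_of_int)
  moreover have "of_int b * x = of_int a"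
    using ab by simp
  ultimately have "of_int b * \<sigma> x = of_int b * x"
    by (metis field_hom_on_of_int)
  then show ?thesis
    using ab(1) by (metis mult_cancel_left of_int_eq_0_iff)
qed

lemma field_hom_on_poly:
  assumes "f \<in> polys_over S" and "S \<subseteq> E" and "\<And>s. s \<in> S \<Longrightarrow> \<sigma> s = s" and "x \<in> E"
  shows "poly f x \<in> E \<and> \<sigma> (poly f x) = poly f (\<sigma> x)"
  using assms(1)
proof (induction rule: polys_over_induct)
  case (pCons a f)
  moreover have "a \<in> E"
    using pCons assms(2) by blast
  ultimately show ?case
    using assms(3,4) by (simp add: field_hom_on_add field_hom_on_mult is_subfield_mult[OF E] is_subfield_add[OF E])
qed (simp add: field_hom_on_0 is_subfield_0[OF E])

text \<open>Applying \<sigma> to the coefficients of a product of linear factors amounts to applying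
  it to the roots. Hence a \<sigma> that permutes the roots fixes the coefficients.\<close>

lemma field_hom_on_coeff_prod_linear:
  assumes "finite A" and "\<And>i. i \<in> A \<Longrightarrow> f i \<in> E"
  shows "(\<Prod>i\<in>A. [:- f i, 1:]) \<in> polys_over E \<and>
    coeff (\<Prod>i\<in>A. [:- \<sigma> (f i), 1:]) k = \<sigma> (coeff (\<Prod>i\<in>A. [:- f i, 1:]) k)"
  using assms
proof (induction A arbitrary: k rule: finite_induct)
  case empty
  then show ?case
    by (auto simp: polys_over_1[OF E] field_hom_on_0 field_hom_on_1 coeff_1)
next
  case (insert i A)
  define P Q where "P = (\<Prod>i\<in>A. [:- f i, 1:])" and "Q = (\<Prod>i\<in>A. [:- \<sigma> (f i), 1:])"
  have P: "P \<in> polys_over E" and Q: "\<And>k. coeff Q k = \<sigma> (coeff P k)"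
    using insert by (simp_all add: P_def Q_def)
  have fi: "f i \<in> E"
    using insert by simp
  have "[:- f i, 1:] \<in> polys_over E"
    using fi by (simp add: polys_over_pCons_iff polys_over_0[OF E] is_subfield_closed[OF E])
  then have "[:- f i, 1:] * P \<in> polys_over E"
    using P by (rule polys_over_mult[OF E])
  moreover have "coeff ([:- \<sigma> (f i), 1:] * Q) k = \<sigma> (coeff ([:- f i, 1:] * P) k)"
  proof -
    have c: "coeff ([:- a, 1:] * R) k = (if k = 0 then 0 else coeff R (k - 1)) - a * coeff R k"
      for a and R :: "'a poly"
      by (cases k) simp_all
    have Pk: "coeff P j \<in> E" for j
      using P by (simp add: polys_over_def)
    show ?thesis
      unfolding c using Pk fi
      by (simp add: Q field_hom_on_diff field_hom_on_mult field_hom_on_0 field_hom_on_minus is_subfield_closed[OF E])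
  qed
  ultimately show ?case
    using insert(1,2) by (simp add: P_def Q_def)
qed

end

section \<open>Galois groups and conjugates\<close>

lemma ring_hom_Qbar_iff: "\<sigma> \<in> ring_hom (subfield_ring E) Qbar \<longleftrightarrow> field_hom_on E \<sigma>"
  by (auto simp: ring_hom_def field_hom_on_def)

lemma Gal_iff:
  "\<sigma> \<in> carrier (Gal E K) \<longleftrightarrow> \<sigma> \<in> Bij E \<and> field_hom_on E \<sigma> \<and> (\<forall>x\<in>K. \<sigma> x = x)"
  by (auto simp: Gal_def ring_hom_def field_hom_on_def dest: Bij_imp_funcset)

lemma group_Gal:
  assumes E: "is_subfield E" and "K \<subseteq> E"
  shows "group (Gal E K)"
proof -
  define H where "H = carrier (Gal E K)"
  have in_E: "\<sigma> x \<in> E" if "\<sigma> \<in> Bij E" "x \<in> E" for \<sigma> x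
    using that Bij_imp_funcset by blast
  have "subgroup H (BijGroup E)"
  proof (rule subgroup.intro)
    show "H \<subseteq> carrier (BijGroup E)"
      by (auto simp: H_def Gal_iff BijGroup_def)
    show "\<one>\<^bsub>BijGroup E\<^esub> \<in> H"
      using assms by (auto simp: H_def Gal_iff BijGroup_def id_Bij field_hom_on_def is_subfield_closed)
    show "\<sigma> \<otimes>\<^bsub>BijGroup E\<^esub> \<rho> \<in> H" if "\<sigma> \<in> H" "\<rho> \<in> H" for \<sigma> \<rho>
    proof -
      have s: "\<sigma> \<in> Bij E" "field_hom_on E \<sigma>" "\<And>x. x \<in> K \<Longrightarrow> \<sigma> x = x"
        and r: "\<rho> \<in> Bij E" "field_hom_on E \<rho>" "\<And>x. x \<in> K \<Longrightarrow> \<rho> x = x"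
        using that by (simp_all add: H_def Gal_iff)
      have "field_hom_on E (compose E \<sigma> \<rho>)"
        using s r E in_E[OF r(1)]
        by (auto simp: field_hom_on_def compose_def is_subfield_closed)
      moreover have "compose E \<sigma> \<rho> x = x" if "x \<in> K" for x
        using s(3) r(3) that assms(2) by (auto simp: compose_def)
      ultimately show ?thesis
        using s(1) r(1) by (simp add: H_def Gal_iff BijGroup_def compose_Bij)
    qed
    show "inv\<^bsub>BijGroup E\<^esub> \<sigma> \<in> H" if "\<sigma> \<in> H" for \<sigma>
    proof -
      have s: "\<sigma> \<in> Bij E" "field_hom_on E \<sigma>" "\<And>x. x \<in> K \<Longrightarrow> \<sigma> x = x"
        using that by (simp_all add: H_def Gal_iff)
      define \<rho> where "\<rho> = (\<lambda>x\<in>E. inv_into E \<sigma> x)"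
      have inj: "inj_on \<sigma> E" and surj: "\<sigma> ` E = E"
        using s(1) by (auto simp: Bij_def bij_betw_def)
      have \<rho>_in: "\<rho> x \<in> E" "\<sigma> (\<rho> x) = x" if "x \<in> E" for x
        using that surj inv_into_into[of x \<sigma> E] f_inv_into_f[of x \<sigma> E] by (auto simp: \<rho>_def)
      have \<rho>_eq: "\<rho> y = x" if "x \<in> E" "\<sigma> x = y" for x y
        using \<rho>_in[of y] that surj inj by (metis imageI inj_onD)
      have "field_hom_on E \<rho>"
        unfolding field_hom_on_def
      proof (intro conjI ballI)
        show "\<rho> 1 = 1"
          using E s(2) by (intro \<rho>_eq) (auto simp: field_hom_on_def is_subfield_closed)
        fix x y assume xy: "x \<in> E" "y \<in> E"
        show "\<rho> (x + y) = \<rho> x + \<rho> y" "\<rho> (x * y) = \<rho> x * \<rho> y"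
          using E s(2) xy by (intro \<rho>_eq; simp add: field_hom_on_def is_subfield_closed \<rho>_in)+
      qed
      moreover have "\<rho> x = x" if "x \<in> K" for x
        using that assms(2) s(3) by (intro \<rho>_eq) auto
      moreover have "\<rho> \<in> Bij E"
        unfolding \<rho>_def by (rule restrict_inv_into_Bij[OF s(1)])
      ultimately show ?thesis
        using s(1) by (simp add: H_def Gal_iff inv_BijGroup \<rho>_def)
    qed
  qed
  then have "group (BijGroup E\<lparr>carrier := H\<rparr>)"
    by (rule subgroup.subgroup_is_group) (rule group_BijGroup)
  moreover have "BijGroup E\<lparr>carrier := H\<rparr> = Gal E K"
    by (simp add: H_def Gal_def)
  ultimately show ?thesis
    by simp
qed

lemma Gal_mult:
  assumes "\<sigma> \<in> carrier (Gal E K)" and "\<rho> \<in> carrier (Gal E K)" and "x \<in> E"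
  shows "(\<sigma> \<otimes>\<^bsub>Gal E K\<^esub> \<rho>) x = \<sigma> (\<rho> x)"
  using assms by (simp add: Gal_iff) (simp add: Gal_def BijGroup_def compose_def)

lemma Gal_one: "x \<in> E \<Longrightarrow> \<one>\<^bsub>Gal E K\<^esub> x = x"
  by (simp add: Gal_def BijGroup_def)

lemma Gal_in: "\<sigma> \<in> carrier (Gal E K) \<Longrightarrow> x \<in> E \<Longrightarrow> \<sigma> x \<in> E"
  using Bij_imp_funcset by (fastforce simp: Gal_iff)

text \<open>\<open>Phi\<close> iterates \<tau> as a function, while generation of the group concerns
  group powers. The comparison is made on \<open>E\<close> because group elements are
  \<open>undefined\<close> outside it.\<close>

lemma Gal_pow:
  assumes "is_subfield E" and "K \<subseteq> E" and "\<sigma> \<in> carrier (Gal E K)" and "x \<in> E"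
  shows "(\<sigma> [^]\<^bsub>Gal E K\<^esub> (n::nat)) x = (\<sigma> ^^ n) x"
  using assms(4)
proof (induction n arbitrary: x)
  case (Suc n)
  interpret group "Gal E K"
    using group_Gal assms(1,2) .
  have "(\<sigma> [^]\<^bsub>Gal E K\<^esub> Suc n) x = (\<sigma> [^]\<^bsub>Gal E K\<^esub> n) (\<sigma> x)"
    using assms(3) Suc.prems by (simp add: Gal_mult)
  also have "\<dots> = (\<sigma> ^^ n) (\<sigma> x)"
    using Suc Gal_in assms(3) by blast
  also have "\<dots> = (\<sigma> ^^ Suc n) x"
    by (simp add: funpow_swap1)
  finally show ?case .
qed (simp add: Gal_one)

text \<open>The polynomial whose roots are the Galois conjugates of \<open>x\<close> is rational, so any conjugate of
  \<open>x\<close> is one of these roots.\<close>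

lemma galois_extension_Rats_hom_in:
  assumes gal: "galois_extension F \<rat>" and hom: "field_hom_on F \<sigma>" and x: "x \<in> F"
  shows "\<sigma> x \<in> F"
proof -
  have F: "is_subfield F"
    using gal by (simp add: galois_extension_def finite_extension_def subfield_Qbar_iff)
  have fixed: "y \<in> \<rat>" if "y \<in> F" "\<And>\<rho>. \<rho> \<in> carrier (Gal F \<rat>) \<Longrightarrow> \<rho> y = y" for y
    using gal that by (auto simp: galois_extension_def)
  interpret G: group "Gal F \<rat>"
    using group_Gal F Rats_subset_is_subfield[OF F] .
  define C where "C = (\<lambda>\<rho>. \<rho> x) ` carrier (Gal F \<rat>)"
  have "C \<subseteq> F"
    unfolding C_def using Gal_in x by blast
  have "x \<in> C"
    unfolding C_def using x by (intro image_eqI[of _ _ "\<one>\<^bsub>Gal F \<rat>\<^esub>"]) (simp_all add: Gal_one)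
  obtain f where f: "f \<in> polys_over \<rat>" "f \<noteq> 0" "poly f x = 0"
    by (rule qbar_algebraic_Rats)
  have "C \<subseteq> {y. poly f y = 0}"
  proof
    fix y assume "y \<in> C"
    then obtain \<rho> where \<rho>: "field_hom_on F \<rho>" "y = \<rho> x"
      by (auto simp: C_def Gal_iff)
    then show "y \<in> {y. poly f y = 0}"
      using field_hom_on_poly[OF F \<rho>(1) f(1) Rats_subset_is_subfield[OF F] field_hom_on_Rats[OF F \<rho>(1)] x]
        f(3) field_hom_on_0[OF F \<rho>(1)] by simp
  qed
  then have fin: "finite C"
    using poly_roots_finite[OF f(2)] finite_subset by blast
  define P where "P = (\<Prod>y\<in>C. [:- y, 1:])"
  have P: "P \<in> polys_over F"
    using field_hom_on_coeff_prod_linear[OF F hom fin, of "\<lambda>y. y"] \<open>C \<subseteq> F\<close> by (auto simp: P_def)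
  have "coeff P k \<in> \<rat>" for k
  proof (rule fixed)
    show "coeff P k \<in> F"
      using P by (simp add: polys_over_def)
    fix \<rho> assume \<rho>: "\<rho> \<in> carrier (Gal F \<rat>)"
    then have hom': "field_hom_on F \<rho>"
      by (simp add: Gal_iff)
    \<comment> \<open>Composition with \<rho> stays in the group, so \<rho> maps the orbit into
      itself; being injective on a finite set, it permutes it.\<close>
    have "\<rho> ` C \<subseteq> C"
    proof
      fix y assume "y \<in> \<rho> ` C"
      then obtain \<rho>' where \<rho>': "\<rho>' \<in> carrier (Gal F \<rat>)" "y = \<rho> (\<rho>' x)"
        by (auto simp: C_def)
      then have "y = (\<rho> \<otimes>\<^bsub>Gal F \<rat>\<^esub> \<rho>') x"
        using \<rho> x by (simp add: Gal_mult)
      then show "y \<in> C"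
        unfolding C_def using \<rho> \<rho>'(1) G.m_closed by blast
    qed
    moreover have "inj_on \<rho> C"
      using field_hom_on_inj[OF F hom'] \<open>C \<subseteq> F\<close> inj_on_subset by blast
    ultimately have "bij_betw \<rho> C C"
      using fin by (simp add: bij_betw_def endo_inj_surj)
    then have "(\<Prod>y\<in>C. [:- \<rho> y, 1:]) = P"
      unfolding P_def by (rule prod.reindex_bij_betw)
    then show "\<rho> (coeff P k) = coeff P k"
      using field_hom_on_coeff_prod_linear[OF F hom' fin, of "\<lambda>y. y" k] \<open>C \<subseteq> F\<close>
      unfolding P_def by (metis subsetD)
  qed
  then have "P \<in> polys_over \<rat>"
    by (simp add: polys_over_def)
  then have "poly P (\<sigma> x) = \<sigma> (poly P x)"
    using field_hom_on_poly[OF F hom _ Rats_subset_is_subfield[OF F] field_hom_on_Rats[OF F hom] x] by simp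
  also have "poly P x = 0"
    using \<open>x \<in> C\<close> fin by (auto simp: P_def poly_prod)
  finally have "poly P (\<sigma> x) = 0"
    using field_hom_on_0[OF F hom] by simp
  then have "\<sigma> x \<in> C"
    using fin by (auto simp: P_def poly_prod)
  then show ?thesis
    using \<open>C \<subseteq> F\<close> by blast
qed

text \<open>Sending f(x) to f(y) is well defined, since \<open>h\<close> divides the difference of
  two polynomials that agree at \<open>x\<close> and so this difference also vanishes at
  \<open>y\<close>. That \<open>y\<close> generates the same field makes the map onto.\<close>

lemma Gal_conjugate_exists:
  fixes x y :: qbar
  assumes F: "is_subfield F" and h: "minimal_poly_over F x h" and y: "poly h y = 0"
    and gen: "adjoin_values F y = adjoin_values F x"
  obtains \<rho> where "\<rho> \<in> carrier (Gal (adjoin_values F x) F)" and "\<rho> x = y"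
proof -
  define L where "L = adjoin_values F x"
  have L: "is_subfield L"
    unfolding L_def by (rule is_subfield_adjoin_values[OF F])
  have agree: "poly f y = poly g y"
    if "f \<in> polys_over F" "g \<in> polys_over F" "poly f x = poly g x" for f g
  proof -
    have "h dvd f - g"
      using that by (intro minimal_poly_over_dvd[OF F h] polys_over_diff[OF F]) simp_all
    then show ?thesis
      using y by (auto elim!: dvdE simp: algebra_simps)
  qed
  have "\<exists>f. v \<in> L \<longrightarrow> f \<in> polys_over F \<and> poly f x = v" for v
    unfolding L_def adjoin_values_def by blast
  then obtain rep where rep: "\<And>v. v \<in> L \<Longrightarrow> rep v \<in> polys_over F" "\<And>v. v \<in> L \<Longrightarrow> poly (rep v) x = v"
    by metis
  define \<rho> where "\<rho> = (\<lambda>v\<in>L. poly (rep v) y)"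
  have \<rho>: "\<rho> (poly f x) = poly f y" if "f \<in> polys_over F" for f
  proof -
    have "poly f x \<in> L"
      using that by (auto simp: L_def adjoin_values_def)
    then show ?thesis
      using agree[OF rep(1) that rep(2)] by (simp add: \<rho>_def)
  qed
  have "field_hom_on L \<rho>"
    unfolding field_hom_on_def
  proof (intro conjI ballI)
    show "\<rho> 1 = 1"
      using \<rho>[OF polys_over_1[OF F]] by simp
    fix u v assume uv: "u \<in> L" "v \<in> L"
    show "\<rho> (u + v) = \<rho> u + \<rho> v"
      using \<rho>[OF polys_over_add[OF F rep(1)[OF uv(1)] rep(1)[OF uv(2)]]] uv rep by (simp add: \<rho>_def)
    show "\<rho> (u * v) = \<rho> u * \<rho> v"
      using \<rho>[OF polys_over_mult[OF F rep(1)[OF uv(1)] rep(1)[OF uv(2)]]] uv rep by (simp add: \<rho>_def)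
  qed
  moreover have "\<rho> ` L = L"
  proof -
    have "\<rho> ` L = adjoin_values F y"
      unfolding adjoin_values_def L_def using \<rho> by (auto simp: image_def)
    then show ?thesis
      using gen by (simp add: L_def)
  qed
  moreover have "\<rho> c = c" if "c \<in> F" for c
    using \<rho>[of "[:c:]"] that by (simp add: polys_over_pCons_iff polys_over_0[OF F])
  moreover have "\<rho> \<in> extensional L"
    by (simp add: \<rho>_def)
  ultimately have "\<rho> \<in> carrier (Gal L F)"
    using field_hom_on_inj[OF L] by (simp add: Gal_iff Bij_def bij_betw_def)
  moreover have "\<rho> x = y"
    using \<rho>[of "[:0, 1:]"] by (simp add: polys_over_pCons_iff polys_over_0[OF F] is_subfield_closed[OF F])
  ultimately show ?thesis
    using that by (simp add: L_def)
qed

section \<open>The Galois action on roots of unity\<close>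

lemma primitive_root_of_unity_inj:
  assumes "primitive_root_of_unity n z"
  shows "inj_on (\<lambda>i. z ^ i) {..<n}"
proof (rule inj_onI)
  have z: "z \<noteq> 0" "\<And>k. 0 < k \<Longrightarrow> k < n \<Longrightarrow> z ^ k \<noteq> 1"
    using assms by (auto simp: primitive_root_of_unity_def power_0_left split: if_splits)
  have less: False if "a < b" "b < n" "z ^ a = z ^ b" for a b
  proof -
    have "z ^ b = z ^ a * z ^ (b - a)"
      using that(1) by (simp flip: power_add)
    then have "z ^ (b - a) = 1"
      using that(3) z(1) by simp
    then show False
      using z(2)[of "b - a"] that by simp
  qed
  fix a b assume "a \<in> {..<n}" "b \<in> {..<n}" "z ^ a = z ^ b"
  then show "a = b"
    using less[of a b] less[of b a] by (metis lessThan_iff nat_neq_iff)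
qed

text \<open>If \<tau>^j fixed \<zeta>, it would be the identity on \<open>L\<close>, so the group
  generated by \<tau> could move \<zeta> to at most \<open>j\<close> places. But all p - 1
  nontrivial powers of \<zeta> are conjugates of \<zeta> over \<open>F\<close>.\<close>

lemma generator_power_moves_root_of_unity:
  assumes p: "prime p" and F: "is_subfield F" and dim: "Qbar.dimension p \<rat> F"
    and \<zeta>: "primitive_root_of_unity p \<zeta>" and L: "L = adjoin_values F (\<zeta> - 1)"
    and \<tau>: "\<tau> \<in> carrier (Gal L F)" and gen: "subgroup_generated (Gal L F) {\<tau>} = Gal L F"
    and j: "0 < j" "j < p - 1"
  shows "(\<tau> ^^ j) \<zeta> \<noteq> \<zeta>"
proof
  assume fix_\<zeta>: "(\<tau> ^^ j) \<zeta> = \<zeta>"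
  have Lf: "is_subfield L" "F \<subseteq> L"
    unfolding L by (simp_all add: is_subfield_adjoin_values adjoin_values_incl F)
  have "\<zeta> - 1 \<in> L"
    unfolding L by (rule adjoin_values_generator[OF F])
  then have \<zeta>_in: "\<zeta> \<in> L"
    using is_subfield_add[OF Lf(1) _ is_subfield_1[OF Lf(1)], of "\<zeta> - 1"] by simp
  interpret G: group "Gal L F"
    using group_Gal Lf .
  define P :: "qbar poly" where "P = map_poly of_int (shifted_cyclotomic p)"
  have root: "(\<zeta> ^ i) ^ p = 1" "\<zeta> ^ i \<noteq> 1" if "i \<in> {1..<p}" for i
  proof -
    have "(\<zeta> ^ i) ^ p = (\<zeta> ^ p) ^ i"
      by (simp add: mult.commute flip: power_mult)
    then show "(\<zeta> ^ i) ^ p = 1" "\<zeta> ^ i \<noteq> 1"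
      using \<zeta> that by (auto simp: primitive_root_of_unity_def)
  qed
  have p1: "1 \<in> {1..<p}"
    using prime_gt_1_nat[OF p] by simp
  have min: "minimal_poly_over F (\<zeta> - 1) P"
    using minimal_poly_over_shifted_cyclotomic[OF p _ _ F dim] root[OF p1] by (simp add: P_def)
  define g where "g = \<tau> [^]\<^bsub>Gal L F\<^esub> j"
  have g_in: "g \<in> carrier (Gal L F)"
    unfolding g_def using \<tau> by simp
  then have g: "field_hom_on L g" "\<And>x. x \<in> F \<Longrightarrow> g x = x"
    by (simp_all add: Gal_iff)
  have "g \<zeta> = \<zeta>"
    unfolding g_def using Gal_pow[OF Lf \<tau> \<zeta>_in] fix_\<zeta> by simp
  then have "g (\<zeta> - 1) = \<zeta> - 1"
    using field_hom_on_diff[OF Lf(1) g(1) \<zeta>_in is_subfield_1[OF Lf(1)]] field_hom_on_1[OF Lf(1) g(1)] by simp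
  then have "g v = v" if "v \<in> L" for v
    using that field_hom_on_poly[OF Lf(1) g(1) _ Lf(2) g(2) \<open>\<zeta> - 1 \<in> L\<close>]
    by (auto simp: L adjoin_values_def)
  moreover have "g \<in> extensional L"
    using g_in by (simp add: Gal_iff Bij_def)
  ultimately have "g = \<one>\<^bsub>Gal L F\<^esub>"
    by (intro extensionalityI[of _ L]) (auto simp: Gal_def BijGroup_def)
  then have pow_j: "\<tau> [^]\<^bsub>Gal L F\<^esub> int j = \<one>\<^bsub>Gal L F\<^esub>"
    by (simp add: g_def int_pow_int)
  have "(\<lambda>i. \<zeta> ^ i) ` {1..<p} \<subseteq> (\<lambda>k. (\<tau> ^^ k) \<zeta>) ` {..<j}"
  proof
    fix y assume "y \<in> (\<lambda>i. \<zeta> ^ i) ` {1..<p}"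
    then obtain i where i: "i \<in> {1..<p}" "y = \<zeta> ^ i"
      by blast
    have y_in: "y - 1 \<in> L"
      using i(2) \<zeta>_in Lf(1) by (simp add: is_subfield_closed)
    have "poly P (y - 1) = 0"
      unfolding P_def i(2)
      using eval_shifted_cyclotomic_eq_0[OF root[OF i(1)]] by (simp add: eval_int_poly_def)
    moreover have "adjoin_values F (y - 1) = adjoin_values F (\<zeta> - 1)"
    proof
      show "adjoin_values F (y - 1) \<subseteq> adjoin_values F (\<zeta> - 1)"
        using adjoin_values_subset[OF F Lf(2,1) y_in] by (simp add: L)
      define M where "M = adjoin_values F (y - 1)"
      have M: "is_subfield M" "F \<subseteq> M" "y - 1 \<in> M"
        unfolding M_def by (simp_all add: is_subfield_adjoin_values adjoin_values_incl adjoin_values_generator F)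
      have "\<not> p dvd i"
        using i(1) by (auto dest: dvd_imp_le)
      then have "coprime i p"
        using prime_imp_coprime[OF p] by (simp add: coprime_commute)
      \<comment> \<open>Inverting \<open>i\<close> modulo \<open>p\<close> recovers \<zeta> as y^l,
        so y - 1 and \<zeta> - 1 generate the same field over \<open>F\<close>.\<close>
      then obtain l where "[i * l = Suc 0] (mod p)"
        using cong_solve_coprime_nat by blast
      then have l: "i * l mod p = 1"
        using prime_gt_1_nat[OF p] by (simp add: cong_def)
      have "y ^ l = \<zeta> ^ (i * l)"
        by (simp add: i(2) flip: power_mult)
      also have "\<dots> = \<zeta> ^ (p * (i * l div p) + i * l mod p)"
        by simp
      also have "\<dots> = (\<zeta> ^ p) ^ (i * l div p) * \<zeta>"
        unfolding power_add power_mult l by simp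
      also have "\<dots> = \<zeta>"
        using \<zeta> by (simp add: primitive_root_of_unity_def)
      finally have "\<zeta> = y ^ l"
        by simp
      moreover have "y \<in> M"
        using is_subfield_add[OF M(1,3) is_subfield_1[OF M(1)]] by simp
      ultimately have "\<zeta> - 1 \<in> M"
        using M(1) by (simp add: is_subfield_closed)
      then show "adjoin_values F (\<zeta> - 1) \<subseteq> adjoin_values F (y - 1)"
        using adjoin_values_subset[OF F M(2,1)] by (simp add: M_def)
    qed
    ultimately obtain \<rho> where \<rho>: "\<rho> \<in> carrier (Gal L F)" "\<rho> (\<zeta> - 1) = y - 1"
      using Gal_conjugate_exists[OF F min] L by metis
    have \<rho>_hom: "field_hom_on L \<rho>"
      using \<rho>(1) by (simp add: Gal_iff)
    have "\<rho> \<zeta> = y"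
      using \<rho>(2) field_hom_on_diff[OF Lf(1) \<rho>_hom \<zeta>_in is_subfield_1[OF Lf(1)]]
        field_hom_on_1[OF Lf(1) \<rho>_hom] by simp
    have "\<rho> \<in> range (\<lambda>n::int. \<tau> [^]\<^bsub>Gal L F\<^esub> n)"
      using G.carrier_subgroup_generated_by_singleton[OF \<tau>] \<rho>(1) gen by simp
    then obtain n :: int where n: "\<rho> = \<tau> [^]\<^bsub>Gal L F\<^esub> n"
      by blast
    \<comment> \<open>Exponents in a generated group are integers; as \<tau>^j is the identity, the
      nonnegative remainder modulo \<open>j\<close> suffices.\<close>
    define k where "k = nat (n mod int j)"
    have k: "n mod int j = int k" "k < j"
      using j(1) by (simp_all add: k_def nat_less_iff)
    have "\<rho> = \<tau> [^]\<^bsub>Gal L F\<^esub> (int j * (n div int j) + int k)"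
      by (simp add: n flip: k(1))
    also have "\<dots> = (\<tau> [^]\<^bsub>Gal L F\<^esub> int j) [^]\<^bsub>Gal L F\<^esub> (n div int j) \<otimes>\<^bsub>Gal L F\<^esub> \<tau> [^]\<^bsub>Gal L F\<^esub> int k"
      using \<tau> by (simp add: G.int_pow_mult G.int_pow_pow)
    also have "\<dots> = \<tau> [^]\<^bsub>Gal L F\<^esub> k"
      unfolding pow_j using \<tau> by (simp add: G.int_pow_one int_pow_int)
    finally have "\<rho> \<zeta> = (\<tau> ^^ k) \<zeta>"
      using Gal_pow[OF Lf \<tau> \<zeta>_in] by simp
    then show "y \<in> (\<lambda>k. (\<tau> ^^ k) \<zeta>) ` {..<j}"
      using \<open>\<rho> \<zeta> = y\<close> k(2) by blast
  qed
  then have "card ((\<lambda>i. \<zeta> ^ i) ` {1..<p}) \<le> card ((\<lambda>k. (\<tau> ^^ k) \<zeta>) ` {..<j})"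
    by (intro card_mono) auto
  also have "\<dots> \<le> j"
    using card_image_le[of "{..<j}" "\<lambda>k. (\<tau> ^^ k) \<zeta>"] by simp
  also have "card ((\<lambda>i. \<zeta> ^ i) ` {1..<p}) = p - 1"
  proof -
    have "inj_on (\<lambda>i. \<zeta> ^ i) {1..<p}"
      using primitive_root_of_unity_inj[OF \<zeta>] by (rule inj_on_subset) auto
    then show ?thesis
      by (simp add: card_image)
  qed
  finally show False
    using j(2) by simp
qed

section \<open>Embeddings and iterates of automorphisms\<close>

lemma embeddings_iff:
  "\<sigma> \<in> embeddings E K \<longleftrightarrow> \<sigma> \<in> extensional E \<and> field_hom_on E \<sigma> \<and> (\<forall>x\<in>K. \<sigma> x = x)"
  by (auto simp: embeddings_def ring_hom_Qbar_iff)

lemma field_hom_on_eq_if_generator_eq: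
  assumes E: "is_subfield E" "E = adjoin_values \<rat> \<theta>"
    and hom: "field_hom_on E \<sigma>" "field_hom_on E \<rho>" and eq: "\<sigma> \<theta> = \<rho> \<theta>" and x: "x \<in> E"
  shows "\<sigma> x = \<rho> x"
proof -
  have \<theta>: "\<theta> \<in> E"
    unfolding E(2) by (rule adjoin_values_generator[OF is_subfield_Rats])
  obtain f where "f \<in> polys_over \<rat>" "x = poly f \<theta>"
    using x unfolding E(2) adjoin_values_def by blast
  then show ?thesis
    using field_hom_on_poly[OF E(1) hom(1) _ Rats_subset_is_subfield[OF E(1)] field_hom_on_Rats[OF E(1) hom(1)] \<theta>]
      field_hom_on_poly[OF E(1) hom(2) _ Rats_subset_is_subfield[OF E(1)] field_hom_on_Rats[OF E(1) hom(2)] \<theta>]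
      eq by metis
qed

text \<open>An embedding is determined by the image of \<theta>, which is a root of a fixed
  polynomial. Finiteness matters because a product over an infinite set has the default value
  1.\<close>

lemma finite_embeddings:
  assumes E: "is_subfield E" "E = adjoin_values \<rat> \<theta>"
  shows "finite (embeddings E K)"
proof -
  have \<theta>: "\<theta> \<in> E"
    unfolding E(2) by (rule adjoin_values_generator[OF is_subfield_Rats])
  obtain f where f: "f \<in> polys_over \<rat>" "f \<noteq> 0" "poly f \<theta> = 0"
    by (rule qbar_algebraic_Rats)
  have "(\<lambda>\<sigma>. \<sigma> \<theta>) ` embeddings E K \<subseteq> {y. poly f y = 0}"
  proof
    fix y assume "y \<in> (\<lambda>\<sigma>. \<sigma> \<theta>) ` embeddings E K"
    then obtain \<sigma> where \<sigma>: "field_hom_on E \<sigma>" "y = \<sigma> \<theta>"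
      by (auto simp: embeddings_iff)
    then show "y \<in> {y. poly f y = 0}"
      using field_hom_on_poly[OF E(1) \<sigma>(1) f(1) Rats_subset_is_subfield[OF E(1)] field_hom_on_Rats[OF E(1) \<sigma>(1)] \<theta>]
        f(3) field_hom_on_0[OF E(1) \<sigma>(1)] by simp
  qed
  then have "finite ((\<lambda>\<sigma>. \<sigma> \<theta>) ` embeddings E K)"
    using poly_roots_finite[OF f(2)] finite_subset by blast
  moreover have "inj_on (\<lambda>\<sigma>. \<sigma> \<theta>) (embeddings E K)"
    using field_hom_on_eq_if_generator_eq[OF E]
    by (intro inj_onI extensionalityI[of _ E]) (auto simp: embeddings_iff)
  ultimately show ?thesis
    by (rule finite_imageD)
qed

text \<open>\<sigma> fixes \<eta> but need not fix \<open>F\<close>; it maps \<open>F\<close> into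
  itself because \<open>F\<close> is Galois over \<rat>. So each F-polynomial in \<eta> goes to
  another one, and \<tau> can be applied to the conjugates in the norm.\<close>

lemma embeddings_in:
  assumes F: "galois_extension F \<rat>" and L: "is_subfield L" "L = adjoin_values F \<eta>" and "\<eta> \<in> K"
    and \<sigma>: "\<sigma> \<in> embeddings L K" and x: "x \<in> L"
  shows "\<sigma> x \<in> L"
proof -
  have F': "is_subfield F"
    using F by (simp add: galois_extension_def finite_extension_def subfield_Qbar_iff)
  have FL: "F \<subseteq> L" "\<eta> \<in> L"
    unfolding L(2) by (simp_all add: adjoin_values_incl adjoin_values_generator F')
  have hom: "field_hom_on L \<sigma>" and "\<sigma> \<eta> = \<eta>"
    using \<sigma> \<open>\<eta> \<in> K\<close> by (auto simp: embeddings_iff)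
  have "poly f \<eta> \<in> L \<and> \<sigma> (poly f \<eta>) \<in> L" if "f \<in> polys_over F" for f
    using that
  proof (induction rule: polys_over_induct)
    case 0
    then show ?case
      using field_hom_on_0[OF L(1) hom] is_subfield_0[OF L(1)] by simp
  next
    case (pCons a f)
    have "\<sigma> a \<in> F"
      using galois_extension_Rats_hom_in[OF F field_hom_on_subset[OF hom FL(1)] pCons(1)] .
    then show ?case
      using pCons FL \<open>\<sigma> \<eta> = \<eta>\<close> field_hom_on_add[OF L(1) hom] field_hom_on_mult[OF L(1) hom]
      by (auto simp: is_subfield_closed[OF L(1)] subset_iff)
  qed
  then show ?thesis
    using x unfolding L(2) adjoin_values_def by blast
qed

lemma Gal_funpow:
  assumes E: "is_subfield E" and "\<tau> \<in> carrier (Gal E K)"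
  shows "x \<in> E \<Longrightarrow> (\<tau> ^^ j) x \<in> E" and "field_hom_on E (\<tau> ^^ j)"
proof -
  have hom: "field_hom_on E \<tau>"
    using assms(2) by (simp add: Gal_iff)
  have *: "(\<tau> ^^ j) x \<in> E" if "x \<in> E" for x j
    by (induction j) (use that Gal_in[OF assms(2)] in auto)
  show "x \<in> E \<Longrightarrow> (\<tau> ^^ j) x \<in> E"
    by (rule *)
  show "field_hom_on E (\<tau> ^^ j)"
  proof (induction j)
    case (Suc j)
    then show ?case
      using hom * by (simp add: field_hom_on_def)
  qed (simp add: field_hom_on_def)
qed

section \<open>Norms and the map \<open>Phi\<close>\<close>

lemma field_norm_mult:
  assumes "is_subfield L" and "x \<in> L" and "y \<in> L"
  shows "field_norm L K (x * y) = field_norm L K x * field_norm L K y"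
  unfolding field_norm_def prod.distrib[symmetric]
  using assms by (intro prod.cong) (auto simp: embeddings_iff field_hom_on_mult)

lemma field_norm_of_Rats:
  assumes "is_subfield L" and "x \<in> \<rat>"
  shows "field_norm L K x = x ^ card (embeddings L K)"
  unfolding field_norm_def
  using assms by (simp add: embeddings_iff field_hom_on_Rats)

context
  fixes L F :: "qbar set" and \<tau>
  assumes L: "is_subfield L" and \<tau>: "\<tau> \<in> carrier (Gal L F)"
begin

lemma Phi_in: "x \<in> L \<Longrightarrow> Phi p e \<tau> x \<in> L"
  unfolding Phi_def using Gal_funpow(1)[OF L \<tau>] by (intro is_subfield_prod is_subfield_power L)

lemma Phi_mult: "x \<in> L \<Longrightarrow> y \<in> L \<Longrightarrow> Phi p e \<tau> (x * y) = Phi p e \<tau> x * Phi p e \<tau> y"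
  using field_hom_on_mult[OF L Gal_funpow(2)[OF L \<tau>]]
  by (simp add: Phi_def power_mult_distrib flip: prod.distrib)

lemma Phi_power: "x \<in> L \<Longrightarrow> Phi p e \<tau> (x ^ n) = Phi p e \<tau> x ^ n"
proof (induction n)
  case 0
  then show ?case
    using field_hom_on_1[OF L Gal_funpow(2)[OF L \<tau>]] by (simp add: Phi_def)
qed (simp add: Phi_mult is_subfield_power[OF L])

lemma Phi_neq_0: "x \<in> L \<Longrightarrow> x \<noteq> 0 \<Longrightarrow> Phi p e \<tau> x \<noteq> 0"
  using field_hom_on_eq_0_iff[OF L Gal_funpow(2)[OF L \<tau>]] by (simp add: Phi_def)

end

section \<open>Membership among the p-th powers\<close>

lemma power_group_mult_power_iff:
  assumes "is_subfield L" and "v \<in> L" and "v \<noteq> 0"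
  shows "u * v ^ n \<in> power_group L n \<longleftrightarrow> u \<in> power_group L n"
proof
  assume "u * v ^ n \<in> power_group L n"
  then obtain w where w: "w \<in> L" "w \<noteq> 0" "u * v ^ n = w ^ n"
    by (auto simp: power_group_def)
  then have "u = (w / v) ^ n"
    using assms(3) by (simp add: power_divide field_simps)
  then show "u \<in> power_group L n"
    using w assms by (auto simp: power_group_def intro!: exI[of _ "w / v"] is_subfield_divide)
next
  assume "u \<in> power_group L n"
  then obtain w where w: "w \<in> L" "w \<noteq> 0" "u = w ^ n"
    by (auto simp: power_group_def)
  then have "u * v ^ n = (w * v) ^ n"
    by (simp add: power_mult_distrib)
  then show "u * v ^ n \<in> power_group L n"
    using w assms by (auto simp: power_group_def intro!: exI[of _ "w * v"] is_subfield_mult)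
qed

text \<open>For n = 2k + 1 one has u = u^n / (u^2)^k, so if u^2 is an n-th power, so is u. This is
  where oddness of \<open>p\<close> enters.\<close>

lemma square_in_power_group_iff:
  assumes L: "is_subfield L" and "u \<in> L" and "odd n"
  shows "u\<^sup>2 \<in> power_group L n \<longleftrightarrow> u \<in> power_group L n"
proof
  assume "u\<^sup>2 \<in> power_group L n"
  then obtain w where w: "w \<in> L" "w \<noteq> 0" "u\<^sup>2 = w ^ n"
    by (auto simp: power_group_def)
  obtain k where k: "n = 2 * k + 1"
    using assms(3) by (rule oddE)
  have "u ^ n = (u\<^sup>2) ^ k * u"
    by (simp add: k power_mult)
  also have "\<dots> = u * (w ^ k) ^ n"
    by (simp add: w(3) mult.commute flip: power_mult)
  finally have "u = (u / w ^ k) ^ n"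
    using w(2) by (simp add: power_divide)
  moreover have "u \<noteq> 0"
    using w by auto
  ultimately show "u \<in> power_group L n"
    using w assms
    by (auto simp: power_group_def intro!: exI[of _ "u / w ^ k"] is_subfield_divide is_subfield_power)
next
  assume "u \<in> power_group L n"
  then obtain w where w: "w \<in> L" "w \<noteq> 0" "u = w ^ n"
    by (auto simp: power_group_def)
  then have "u\<^sup>2 = (w\<^sup>2) ^ n"
    by (simp add: mult.commute flip: power_mult)
  then show "u\<^sup>2 \<in> power_group L n"
    using w L by (auto simp: power_group_def intro!: exI[of _ "w\<^sup>2"] is_subfield_power)
qed

lemma Phi_norm_not_power_exists:
  fixes L F K :: "qbar set"
  assumes p: "prime p" and e: "coprime p e"
    and F: "galois_extension F \<rat>" and dim: "Qbar.dimension p \<rat> F"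
    and \<zeta>: "primitive_root_of_unity p \<zeta>"
    and L: "is_subfield L" "L = adjoin_values F (\<zeta> - 1)" "L = adjoin_values \<rat> \<theta>"
    and K: "is_subfield K" "\<zeta> \<in> K" "K \<subseteq> L"
    and \<tau>: "\<tau> \<in> carrier (Gal L F)" "subgroup_generated (Gal L F) {\<tau>} = Gal L F"
  obtains x where "x \<in> L - {0}" and "Phi p e \<tau> (field_norm L K x) \<notin> power_group L p"
proof -
  have F': "is_subfield F"
    using F by (simp add: galois_extension_def finite_extension_def subfield_Qbar_iff)
  have \<theta>: "\<theta> \<in> L"
    unfolding L(3) by (rule adjoin_values_generator[OF is_subfield_Rats])
  have \<eta>: "\<zeta> - 1 \<in> K"
    using K by (simp add: is_subfield_closed)
  have \<zeta>_in: "\<zeta> \<in> L"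
    using K by blast
  define I where "I = {0..p - 2} \<times> embeddings L K"
  define t where "t = (\<lambda>(j, \<sigma>). (\<tau> ^^ j) (\<sigma> \<theta>))"
  define n where "n = (\<lambda>(j, \<sigma> :: qbar \<Rightarrow> qbar). e ^ (p - 2 - j))"
  \<comment> \<open>Embeddings are extensional, so the identity enters as its restriction to
    \<open>L\<close>.\<close>
  define \<iota> where "\<iota> = (\<lambda>x\<in>L. x)"
  have fin: "finite (embeddings L K)"
    by (rule finite_embeddings[OF L(1,3)])
  have emb_in: "\<sigma> x \<in> L" if "\<sigma> \<in> embeddings L K" "x \<in> L" for \<sigma> x
    using embeddings_in[OF F L(1,2) \<eta>] that .
  have \<iota>: "\<iota> \<in> embeddings L K"
    using K(3) L(1) by (auto simp: \<iota>_def embeddings_iff field_hom_on_def is_subfield_closed)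
  have pow_hom: "field_hom_on L (\<tau> ^^ j)" and pow_in: "x \<in> L \<Longrightarrow> (\<tau> ^^ j) x \<in> L" for j x
    using Gal_funpow[OF L(1) \<tau>(1)] by blast+
  have t_neq: "t i \<noteq> \<theta>" if i_in: "i \<in> I - {(0, \<iota>)}" for i
  proof
    assume eq: "t i = \<theta>"
    obtain j \<sigma> where i: "i = (j, \<sigma>)" "j \<le> p - 2" "\<sigma> \<in> embeddings L K"
      using i_in by (auto simp: I_def)
    have \<sigma>: "field_hom_on L \<sigma>" "\<sigma> \<zeta> = \<zeta>" "\<sigma> \<in> extensional L"
      using i(3) K(2) by (auto simp: embeddings_iff)
    have "field_hom_on L (\<lambda>x. (\<tau> ^^ j) (\<sigma> x))"
      using \<sigma>(1) pow_hom[of j] emb_in[OF i(3)] by (simp add: field_hom_on_def)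
    moreover have "field_hom_on L (\<lambda>x. x)"
      by (simp add: field_hom_on_def)
    \<comment> \<open>A homomorphism that fixes the generator \<theta> is the identity on
      \<open>L\<close>. Evaluated at \<zeta>, which \<sigma> fixes, it says that \<tau>^j fixes
      \<zeta>.\<close>
    ultimately have id: "(\<tau> ^^ j) (\<sigma> x) = x" if "x \<in> L" for x
      using field_hom_on_eq_if_generator_eq[OF L(1,3), of "\<lambda>x. (\<tau> ^^ j) (\<sigma> x)" "\<lambda>x. x"] eq that
      by (simp add: t_def i(1))
    have "(\<tau> ^^ j) \<zeta> = \<zeta>"
      using id[OF \<zeta>_in] \<sigma>(2) by simp
    moreover have "j < p - 1"
      using i(2) prime_gt_1_nat[OF p] by simp
    ultimately have "j = 0"
      using generator_power_moves_root_of_unity[OF p F' dim \<zeta> L(2) \<tau>] by blast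
    then have "\<sigma> x = \<iota> x" if "x \<in> L" for x
      using id[OF that] that by (simp add: \<iota>_def)
    then have "\<sigma> = \<iota>"
      using \<sigma>(3) by (intro extensionalityI[of _ L]) (auto simp: \<iota>_def)
    then show False
      using i_in i(1) \<open>j = 0\<close> by simp
  qed
  have t_in: "t i \<in> rational_values \<theta>" if "i \<in> I" for i
    using that pow_in emb_in \<theta> unfolding rational_values_eq_adjoin_values L(3)[symmetric]
    by (auto simp: I_def t_def)
  have n: "\<not> p dvd n (0, \<iota>)"
  proof
    assume "p dvd n (0, \<iota>)"
    then have "p dvd e"
      using p by (auto simp: n_def dest: prime_dvd_power)
    then show False
      using e p by (metis coprime_absorb_left not_prime_unit)
  qed
  obtain a :: int where a: "\<And>w. w \<in> L \<Longrightarrow> w ^ p \<noteq> (\<Prod>i\<in>I. (t i - of_int a) ^ n i)"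
    using shifted_product_not_power[OF qbar_algebraic, of I "(0, \<iota>)" t \<theta> p n]
      fin \<iota> t_neq t_in n \<theta> L(3)
    by (auto simp: I_def t_def \<iota>_def rational_values_eq_adjoin_values)
  define x where "x = \<theta> - of_int a"
  have x: "x \<in> L"
    using \<theta> L(1) by (simp add: x_def is_subfield_closed)
  have "Phi p e \<tau> (field_norm L K x) = (\<Prod>j = 0..p - 2. \<Prod>\<sigma>\<in>embeddings L K. (t (j, \<sigma>) - of_int a) ^ n (j, \<sigma>))"
    unfolding Phi_def
  proof (intro prod.cong refl)
    fix j
    have "(\<tau> ^^ j) (field_norm L K x) = (\<Prod>\<sigma>\<in>embeddings L K. (\<tau> ^^ j) (\<sigma> x))"
      unfolding field_norm_def using emb_in x by (intro field_hom_on_prod[OF L(1) pow_hom])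
    also have "\<dots> = (\<Prod>\<sigma>\<in>embeddings L K. t (j, \<sigma>) - of_int a)"
    proof (intro prod.cong refl)
      fix \<sigma> assume \<sigma>: "\<sigma> \<in> embeddings L K"
      then have hom: "field_hom_on L \<sigma>"
        by (simp add: embeddings_iff)
      have "\<sigma> x = \<sigma> \<theta> - of_int a"
        unfolding x_def using \<theta> is_subfield_of_int[OF L(1)]
        by (simp add: field_hom_on_diff[OF L(1) hom] field_hom_on_of_int[OF L(1) hom])
      then show "(\<tau> ^^ j) (\<sigma> x) = t (j, \<sigma>) - of_int a"
        using emb_in[OF \<sigma> \<theta>] is_subfield_of_int[OF L(1)]
        by (simp add: t_def field_hom_on_diff[OF L(1) pow_hom] field_hom_on_of_int[OF L(1) pow_hom])
    qed
    finally show "(\<tau> ^^ j) (field_norm L K x) ^ e ^ (p - 2 - j)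
        = (\<Prod>\<sigma>\<in>embeddings L K. (t (j, \<sigma>) - of_int a) ^ n (j, \<sigma>))"
      by (simp add: n_def prod_power_distrib)
  qed
  also have "\<dots> = (\<Prod>i\<in>I. (t i - of_int a) ^ n i)"
    unfolding I_def by (simp add: prod.cartesian_product)
  finally have eq: "Phi p e \<tau> (field_norm L K x) = (\<Prod>i\<in>I. (t i - of_int a) ^ n i)" .
  have "x \<noteq> 0"
  \<comment> \<open>If x were 0, the factor at (0, \<iota>) would make the product 0 = 0^p; the
    choice of \<open>a\<close> excludes every w in \<open>L\<close>, including 0.\<close>
  proof
    assume "x = 0"
    moreover have "n (0, \<iota>) \<noteq> 0"
      using n by (metis dvd_0_right)
    moreover have "(0, \<iota>) \<in> I"
      using \<iota> by (simp add: I_def)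
    ultimately have "(\<Prod>i\<in>I. (t i - of_int a) ^ n i) = 0"
      using fin \<theta> by (intro prod_zero bexI[of _ "(0, \<iota>)"]) (auto simp: I_def t_def \<iota>_def x_def)
    then show False
      using a[of 0] is_subfield_0[OF L(1)] prime_gt_0_nat[OF p] by (simp add: power_0_left)
  qed
  moreover have "Phi p e \<tau> (field_norm L K x) \<notin> power_group L p"
    unfolding eq power_group_def using a by fastforce
  ultimately show ?thesis
    using that x by blast
qed

section \<open>The fields of the theorem and the infinite family\<close>

text \<open>Generated fields are replaced by polynomial values. The generator is \<zeta> - 1 because
  that is the root of the Eisenstein polynomial.\<close>

lemma compositum_adjoin:
  assumes F: "is_subfield F"
  shows "compositum F (adjoin \<rat> \<zeta>) = adjoin_values F (\<zeta> - 1)"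
    and "is_subfield (adjoin \<rat> \<zeta>)" and "\<zeta> \<in> adjoin \<rat> \<zeta>"
    and "adjoin \<rat> \<zeta> \<subseteq> compositum F (adjoin \<rat> \<zeta>)"
proof -
  define K L where "K = adjoin \<rat> \<zeta>" and "L = compositum F K"
  have KL: "is_subfield K" "is_subfield L"
    unfolding K_def L_def adjoin_def compositum_def subfield_Qbar_iff[symmetric]
    by (simp_all add: field.generate_field_is_subfield[OF field_Qbar])
  have sub: "\<zeta> \<in> K" "F \<subseteq> L" "K \<subseteq> L"
    unfolding K_def L_def adjoin_def compositum_def by (auto intro: generate_field.incl)
  define M where "M = adjoin_values F (\<zeta> - 1)"
  have M: "is_subfield M" "F \<subseteq> M" "\<zeta> - 1 \<in> M"
    by (simp_all add: M_def F is_subfield_adjoin_values adjoin_values_incl adjoin_values_generator)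
  then have "\<zeta> \<in> M"
    using is_subfield_add[OF M(1,3) is_subfield_1[OF M(1)]] by simp
  then have "K \<subseteq> M"
    unfolding K_def adjoin_def using M(1) Rats_subset_is_subfield[OF M(1)]
    by (intro field.generate_field_min_subfield1[OF field_Qbar]) (simp_all add: subfield_Qbar_iff)
  then have "L \<subseteq> M"
    unfolding L_def compositum_def using M
    by (intro field.generate_field_min_subfield1[OF field_Qbar]) (simp_all add: subfield_Qbar_iff)
  moreover have "\<zeta> - 1 \<in> L"
    using sub KL by (auto intro: is_subfield_closed)
  then have "M \<subseteq> L"
    unfolding M_def using adjoin_values_subset[OF F sub(2) KL(2)] by blast
  ultimately show "compositum F (adjoin \<rat> \<zeta>) = adjoin_values F (\<zeta> - 1)"
    by (simp add: L_def K_def M_def)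
  show "is_subfield (adjoin \<rat> \<zeta>)" "\<zeta> \<in> adjoin \<rat> \<zeta>" "adjoin \<rat> \<zeta> \<subseteq> compositum F (adjoin \<rat> \<zeta>)"
    using KL sub by (simp_all add: K_def L_def)
qed

theorem corollary3p4:
  fixes p e :: nat and \<zeta> :: qbar and F K L :: "qbar set" and \<tau> :: "qbar \<Rightarrow> qbar"
  assumes "prime p" and "odd p"
    and "cyclic_extension p F \<rat>"
    and "primitive_root_of_unity p \<zeta>"
    and "K = adjoin \<rat> \<zeta>"
    and "L = compositum F K"
    and "\<tau> \<in> carrier (Gal L F)" and "subgroup_generated (Gal L F) {\<tau>} = Gal L F"
    and "residue_primroot p e"
  shows "infinite {x \<in> L - {0}.
           Phi p e \<tau> (field_norm L K x) \<notin> power_group L p \<and>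
           Phi p e \<tau> (\<zeta> * field_norm L K x) \<notin> power_group L p}"
proof -
  have gal: "galois_extension F \<rat>" and dim: "Qbar.dimension p \<rat> F"
    using assms(3) by (simp_all add: cyclic_extension_def)
  have F: "is_subfield F"
    using gal by (simp add: galois_extension_def finite_extension_def subfield_Qbar_iff)
  have L: "L = adjoin_values F (\<zeta> - 1)" and K: "is_subfield K" "\<zeta> \<in> K" "K \<subseteq> L"
    unfolding assms(5,6) using compositum_adjoin[OF F] by simp_all
  have Lf: "is_subfield L" "F \<subseteq> L" "\<zeta> - 1 \<in> L"
    by (simp_all add: L F is_subfield_adjoin_values adjoin_values_incl adjoin_values_generator)
  have \<zeta>: "\<zeta> \<in> L"
    using K by blast
  have QF: "\<rat> \<subseteq> F"
    by (rule Rats_subset_is_subfield[OF F])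
  have "F \<noteq> \<rat>"
  proof
    assume "F = \<rat>"
    moreover have "subfield (\<rat> :: qbar set) Qbar"
      by (simp add: subfield_Qbar_iff is_subfield_Rats)
    ultimately have "p = 1"
      using dim Qbar.dimension_one Qbar.dimension_is_inj by blast
    then show False
      using assms(1) by simp
  qed
  then obtain \<beta> where \<beta>: "\<beta> \<in> F" "\<beta> \<notin> \<rat>"
    using QF by blast
  have F_eq: "adjoin_values \<rat> \<beta> = F"
    by (rule adjoin_values_prime_dimension[OF is_subfield_Rats F QF assms(1) dim \<beta>])
  \<comment> \<open>\<beta> generates \<open>F\<close> over \<rat> and \<zeta> - 1 generates
    \<open>L\<close> over \<open>F\<close>, so one integral combination generates \<open>L\<close>
    over \<rat>.\<close>
  obtain m :: int where m: "\<beta> \<in> adjoin_values \<rat> (\<beta> + of_int m * (\<zeta> - 1))"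
      "\<zeta> - 1 \<in> adjoin_values \<rat> (\<beta> + of_int m * (\<zeta> - 1))"
    by (rule primitive_element_qbar)
  define \<theta> where "\<theta> = \<beta> + of_int m * (\<zeta> - 1)"
  define M where "M = adjoin_values \<rat> \<theta>"
  have M: "is_subfield M" "\<rat> \<subseteq> M"
    by (simp_all add: M_def is_subfield_adjoin_values adjoin_values_incl is_subfield_Rats)
  have "F \<subseteq> M"
    using adjoin_values_subset[OF is_subfield_Rats M(2,1)] m(1) by (simp add: M_def \<theta>_def flip: F_eq)
  then have "L \<subseteq> M"
    unfolding L using adjoin_values_subset[OF F _ M(1)] m(2) by (simp add: M_def \<theta>_def)
  moreover have "\<theta> \<in> L"
    unfolding \<theta>_def using \<beta>(1) Lf by (auto intro!: is_subfield_add is_subfield_mult is_subfield_of_int)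
  then have "M \<subseteq> L"
    unfolding M_def using adjoin_values_subset[OF is_subfield_Rats _ Lf(1)] QF Lf(2) by blast
  ultimately have L_eq: "L = adjoin_values \<rat> \<theta>"
    by (simp add: M_def)
  have e: "coprime p e"
    using assms(9) by (simp add: residue_primroot_def)
  obtain x0 where x0: "x0 \<in> L - {0}" "Phi p e \<tau> (field_norm L K x0) \<notin> power_group L p"
    by (rule Phi_norm_not_power_exists[OF assms(1) e gal dim assms(4) Lf(1) L L_eq K assms(7,8)])
  have norm_in: "field_norm L K x \<in> L" if "x \<in> L" for x
    unfolding field_norm_def
    using embeddings_in[OF gal Lf(1) L is_subfield_diff[OF K(1,2) is_subfield_1[OF K(1)]] _ that]
    by (intro is_subfield_prod[OF Lf(1)])
  note Phi_rules = Phi_in[OF Lf(1) assms(7)] Phi_mult[OF Lf(1) assms(7)]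
  define A where "A = {x \<in> L - {0}. Phi p e \<tau> (field_norm L K x) \<notin> power_group L p \<and>
           Phi p e \<tau> (\<zeta> * field_norm L K x) \<notin> power_group L p}"
  have "\<exists>x. x \<in> A"
  proof (cases "Phi p e \<tau> (\<zeta> * field_norm L K x0) \<in> power_group L p")
    case False
    then show ?thesis
      using x0 by (auto simp: A_def)
  next
    case True
    define u where "u = Phi p e \<tau> (field_norm L K x0)"
    have u: "u \<in> L" "u \<notin> power_group L p"
      using x0 norm_in Phi_rules(1) by (simp_all add: u_def)
    obtain v where v: "v \<in> L" "v \<noteq> 0" "Phi p e \<tau> (\<zeta> * field_norm L K x0) = v ^ p"
      using True by (auto simp: power_group_def)
    have norm: "field_norm L K (x0 * x0) = field_norm L K x0 * field_norm L K x0"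
      using x0(1) field_norm_mult[OF Lf(1)] by simp
    have "Phi p e \<tau> (field_norm L K (x0 * x0)) = u\<^sup>2"
      unfolding norm u_def using x0(1) norm_in Phi_rules(2) by (simp add: power2_eq_square)
    moreover have "Phi p e \<tau> (\<zeta> * field_norm L K (x0 * x0)) = u * v ^ p"
      unfolding norm u_def v(3)[symmetric] mult.assoc[symmetric]
      using x0(1) norm_in Phi_rules(2) \<zeta> is_subfield_mult[OF Lf(1)] by simp
    ultimately have "x0 * x0 \<in> A"
      using x0(1) u v(1,2) square_in_power_group_iff[OF Lf(1) u(1) assms(2)]
        power_group_mult_power_iff[OF Lf(1) v(1,2)] is_subfield_mult[OF Lf(1)]
      by (simp add: A_def)
    then show ?thesis
      by blast
  qed
  then obtain x where x: "x \<in> A"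
    by blast
  \<comment> \<open>Using \<open>Suc k\<close> keeps the multiplier nonzero.\<close>
  have "x * of_nat (Suc k) ^ p \<in> A" for k
  proof -
    define c :: qbar where "c = of_nat (Suc k)"
    define d where "d = card (embeddings L K)"
    have c: "c \<in> L" "c \<noteq> 0" "c ^ p \<in> L"
      by (simp_all add: c_def is_subfield_closed[OF Lf(1)] del: of_nat_Suc)
    have xL: "x \<in> L" "x \<noteq> 0"
      using x by (simp_all add: A_def)
    \<comment> \<open>Embeddings fix rational numbers, so the norm of c^p is the p-th power of c^d.
      Then \<Phi> changes only by a p-th power of a nonzero element of \<open>L\<close>.\<close>
    have "field_norm L K (c ^ p) = (c ^ p) ^ d"
      unfolding d_def by (rule field_norm_of_Rats[OF Lf(1)]) (simp add: c_def del: of_nat_Suc)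
    then have norm: "field_norm L K (x * c ^ p) = field_norm L K x * (c ^ d) ^ p"
      using field_norm_mult[OF Lf(1) xL(1) c(3)] by (simp add: mult.commute flip: power_mult)
    have cd: "c ^ d \<in> L" "c ^ d \<noteq> 0" "(c ^ d) ^ p \<in> L"
      using c by (simp_all add: is_subfield_closed[OF Lf(1)])
    have *: "Phi p e \<tau> (y * (c ^ d) ^ p) \<in> power_group L p \<longleftrightarrow> Phi p e \<tau> y \<in> power_group L p"
      if "y \<in> L" for y
      using that Phi_rules cd Phi_power[OF Lf(1) assms(7) cd(1)] Phi_neq_0[OF Lf(1) assms(7) cd(1,2)]
      by (simp add: power_group_mult_power_iff[OF Lf(1)])
    have "x * c ^ p \<in> A"
      using x c xL *[OF norm_in[OF xL(1)]] *[OF is_subfield_mult[OF Lf(1) \<zeta> norm_in[OF xL(1)]]]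
      by (simp add: A_def norm is_subfield_mult[OF Lf(1)] flip: mult.assoc)
    then show ?thesis
      by (simp add: c_def)
  qed
  moreover have "inj (\<lambda>k. x * of_nat (Suc k) ^ p)"
  proof (rule injI)
    fix k l assume "x * of_nat (Suc k) ^ p = x * of_nat (Suc l) ^ p"
    then have "(of_nat (Suc k ^ p) :: qbar) = of_nat (Suc l ^ p)"
      using x by (simp add: A_def del: of_nat_Suc)
    then have "Suc k ^ p = Suc l ^ p"
      by (simp only: of_nat_eq_iff)
    then show "k = l"
      using prime_gt_0_nat[OF assms(1)] power_eq_iff_eq_base[of p "Suc k" "Suc l"] by simp
  qed
  ultimately have "infinite A"
    by (metis infinite_iff_countable_subset image_subsetI)
  then show ?thesis
    by (simp add: A_def)
qed

end
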